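(* Let $M$ be a nonempty countable set of unary diamond modalities, let $V$ be a variety of $M$-BAOs, and suppose that for some integer $n$ with $0<n<\omega$ the logic of $V$ contains $KU_n^M$ (that is, $V$ validates every formula in $U_n^M$). Then $V$ is resolved: either $V$ is totally canonical, or $V$ is not $(|M|+\omega)$-canonical.
   Context: Modal $M$-formulas are built from atoms $q_0,q_1,\dots$ using $\top,\neg,\vee$ and the diamonds in $M$. For each diamond in $M$, the dual box abbreviates $\neg$(diamond)$\neg$; the dual of $\Diamond$ is written $\Box$ and the dual of $\Diamond'$ is written $\blacksquare$. A normal modal $M$-logic is a set of $M$-formulas containing all propositional tautologies, $\Box(p\to q)\to(\Box p\to\Box q)$ and $\Diamond p\leftrightarrow\neg\Box\neg p$ for each $\Diamond\in M$, closed under modus ponens, generalisation for each box, and uniform substitution. $U_n^M$ is the set of all formulas $\bigvee_{i\le n}\Box\bigl(\blacksquare q_i\to\bigvee_{j\le n,\,j\ne i}\blacksquare q_j\bigr)$ for $\Diamond,\Diamond'\in M$ (possibly equal), with $i,j$ ranging over $\{0,\dots,n\}$. $KU_n^M$ is the smallest normal modal $M$-logic containing $U_n^M$. An $M$-BAO is a boolean algebra with, for each $\Diamond\in M$, an operation $\Diamond$ satisfying $\Diamond 0=0$ and $\Diamond(a+b)=\Diamond a+\Diamond b$. A variety of $M$-BAOs is a class of $M$-BAOs defined by a set of equations. $M$-formulas translate to $M$-BAO terms in the usual way (atoms become variables); $V$ validates $\varphi$ if its translation is identically $1$ in every algebra of $V$; the logic of $V$ is the set of all formulas validated by $V$. The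 canonical frame $\mathcal A_+$ of an $M$-BAO $\mathcal A$ has the ultrafilters of $\mathcal A$ as points, with $R_\Diamond\mu\nu$ iff $\Diamond a\in\mu$ for every $a\in\nu$. The canonical extension $\mathcal A^\sigma$ is the $M$-BAO of all subsets of $\mathcal A_+$ with $\Diamond X=\{\mu:\exists\nu\in X\ R_\Diamond\mu\nu\}$. For a cardinal $\kappa$, $V$ is $\kappa$-canonical if $\mathcal A^\sigma\in V$ for every $\mathcal A\in V$ generated as an algebra by a subset of cardinality at most $\kappa$; $V$ is totally canonical if $\mathcal A^\sigma\in V$ for every $\mathcal A\in V$. *)

theory Defs
  imports "HOL-Library.Countable_Set"
begin

unbundle cardinal_syntax

datatype (mods: 'm) fm =
    Atom nat
  | Top
  | Neg "'m fm"
  | Or "'m fm" "'m fm"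
  | Dia 'm "'m fm"

definition formulas :: "'m set \<Rightarrow> 'm fm set" where
  "formulas M = {\<phi>. mods \<phi> \<subseteq> M}"

definition Imp :: "'m fm \<Rightarrow> 'm fm \<Rightarrow> 'm fm" where
  "Imp \<phi> \<psi> = Or (Neg \<phi>) \<psi>"

definition And :: "'m fm \<Rightarrow> 'm fm \<Rightarrow> 'm fm" where
  "And \<phi> \<psi> = Neg (Or (Neg \<phi>) (Neg \<psi>))"

definition Iff :: "'m fm \<Rightarrow> 'm fm \<Rightarrow> 'm fm" where
  "Iff \<phi> \<psi> = And (Imp \<phi> \<psi>) (Imp \<psi> \<phi>)"

definition Box :: "'m \<Rightarrow> 'm fm \<Rightarrow> 'm fm" where
  "Box d \<phi> = Neg (Dia d (Neg \<phi>))"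

fun Disj :: "'m fm list \<Rightarrow> 'm fm" where
  "Disj [] = Neg Top"
| "Disj [\<phi>] = \<phi>"
| "Disj (\<phi> # \<psi> # \<phi>s) = Or \<phi> (Disj (\<psi> # \<phi>s))"

primrec subst :: "(nat \<Rightarrow> 'm fm) \<Rightarrow> 'm fm \<Rightarrow> 'm fm" where
  "subst \<sigma> (Atom k) = \<sigma> k"
| "subst \<sigma> Top = Top"
| "subst \<sigma> (Neg \<phi>) = Neg (subst \<sigma> \<phi>)"
| "subst \<sigma> (Or \<phi> \<psi>) = Or (subst \<sigma> \<phi>) (subst \<sigma> \<psi>)"
| "subst \<sigma> (Dia d \<phi>) = Dia d (subst \<sigma> \<phi>)"

text \<open>Truth under a propositional valuation \<open>v\<close>, which assigns truth values freely to the
  atoms and to the formulas with outermost symbol a diamond.\<close>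

primrec prop_true :: "('m fm \<Rightarrow> bool) \<Rightarrow> 'm fm \<Rightarrow> bool" where
  "prop_true v (Atom k) = v (Atom k)"
| "prop_true v Top = True"
| "prop_true v (Neg \<phi>) = (\<not> prop_true v \<phi>)"
| "prop_true v (Or \<phi> \<psi>) = (prop_true v \<phi> \<or> prop_true v \<psi>)"
| "prop_true v (Dia d \<phi>) = v (Dia d \<phi>)"

definition tautology :: "'m fm \<Rightarrow> bool" where
  "tautology \<phi> \<longleftrightarrow> (\<forall>v. prop_true v \<phi>)"

definition normal_logic :: "'m set \<Rightarrow> 'm fm set \<Rightarrow> bool" where
  "normal_logic M L \<longleftrightarrow>
     L \<subseteq> formulas M \<and>
     (\<forall>\<phi>\<in>formulas M. tautology \<phi> \<longrightarrow> \<phi> \<in> L) \<and>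
     (\<forall>d\<in>M. Imp (Box d (Imp (Atom 0) (Atom 1))) (Imp (Box d (Atom 0)) (Box d (Atom 1))) \<in> L) \<and>
     (\<forall>d\<in>M. Iff (Dia d (Atom 0)) (Neg (Box d (Neg (Atom 0)))) \<in> L) \<and>
     (\<forall>\<phi> \<psi>. \<phi> \<in> L \<longrightarrow> Imp \<phi> \<psi> \<in> L \<longrightarrow> \<psi> \<in> L) \<and>
     (\<forall>d\<in>M. \<forall>\<phi>\<in>L. Box d \<phi> \<in> L) \<and>
     (\<forall>\<sigma>. range \<sigma> \<subseteq> formulas M \<longrightarrow> (\<forall>\<phi>\<in>L. subst \<sigma> \<phi> \<in> L))"

definition U_formula :: "nat \<Rightarrow> 'm \<Rightarrow> 'm \<Rightarrow> 'm fm" where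
  "U_formula n d d' =
     Disj (map (\<lambda>i. Box d (Imp (Box d' (Atom i))
                              (Disj (map (\<lambda>j. Box d' (Atom j)) (filter (\<lambda>j. j \<noteq> i) [0..<Suc n])))))
               [0..<Suc n])"

definition U :: "nat \<Rightarrow> 'm set \<Rightarrow> 'm fm set" where
  "U n M = {U_formula n d d' | d d'. d \<in> M \<and> d' \<in> M}"

definition KU :: "nat \<Rightarrow> 'm set \<Rightarrow> 'm fm set" where
  "KU n M = \<Inter> {L. normal_logic M L \<and> U n M \<subseteq> L}"

text \<open>Algebras are records with an explicit carrier set, so that each type hosts algebras of all
  cardinalities up to its own.  The values of the operations outside the carrier, and of the
  operators for modalities outside \<open>M\<close>, are irrelevant.\<close>

record ('a, 'm) algebra =
  carrier :: "'a set"
  join :: "'a \<Rightarrow> 'a \<Rightarrow> 'a"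
  compl :: "'a \<Rightarrow> 'a"
  zero :: 'a
  one :: 'a
  dia :: "'m \<Rightarrow> 'a \<Rightarrow> 'a"

definition meet :: "('a, 'm) algebra \<Rightarrow> 'a \<Rightarrow> 'a \<Rightarrow> 'a" where
  "meet A a b = compl A (join A (compl A a) (compl A b))"

definition below :: "('a, 'm) algebra \<Rightarrow> 'a \<Rightarrow> 'a \<Rightarrow> bool" where
  "below A a b \<longleftrightarrow> join A a b = b"

text \<open>The boolean axioms are those of \<^locale>\<open>abstract_boolean_algebra\<close>, relativised to the carrier.
  The trivial algebra, in which zero and one coincide, is included.\<close>

locale bao =
  fixes M :: "'m set" and A :: "('a, 'm) algebra"
  assumes zero_closed: "zero A \<in> carrier A"
    and one_closed: "one A \<in> carrier A"
    and compl_closed: "a \<in> carrier A \<Longrightarrow> compl A a \<in> carrier A"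
    and join_closed: "a \<in> carrier A \<Longrightarrow> b \<in> carrier A \<Longrightarrow> join A a b \<in> carrier A"
    and dia_closed: "d \<in> M \<Longrightarrow> a \<in> carrier A \<Longrightarrow> dia A d a \<in> carrier A"
    and join_assoc: "a \<in> carrier A \<Longrightarrow> b \<in> carrier A \<Longrightarrow> c \<in> carrier A \<Longrightarrow>
      join A (join A a b) c = join A a (join A b c)"
    and join_comm: "a \<in> carrier A \<Longrightarrow> b \<in> carrier A \<Longrightarrow> join A a b = join A b a"
    and meet_assoc: "a \<in> carrier A \<Longrightarrow> b \<in> carrier A \<Longrightarrow> c \<in> carrier A \<Longrightarrow>
      meet A (meet A a b) c = meet A a (meet A b c)"
    and meet_comm: "a \<in> carrier A \<Longrightarrow> b \<in> carrier A \<Longrightarrow> meet A a b = meet A b a"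
    and meet_join_distrib: "a \<in> carrier A \<Longrightarrow> b \<in> carrier A \<Longrightarrow> c \<in> carrier A \<Longrightarrow>
      meet A a (join A b c) = join A (meet A a b) (meet A a c)"
    and join_meet_distrib: "a \<in> carrier A \<Longrightarrow> b \<in> carrier A \<Longrightarrow> c \<in> carrier A \<Longrightarrow>
      join A a (meet A b c) = meet A (join A a b) (join A a c)"
    and meet_one: "a \<in> carrier A \<Longrightarrow> meet A a (one A) = a"
    and join_zero: "a \<in> carrier A \<Longrightarrow> join A a (zero A) = a"
    and meet_compl: "a \<in> carrier A \<Longrightarrow> meet A a (compl A a) = zero A"
    and join_compl: "a \<in> carrier A \<Longrightarrow> join A a (compl A a) = one A"
    and dia_zero: "d \<in> M \<Longrightarrow> dia A d (zero A) = zero A"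
    and dia_join: "d \<in> M \<Longrightarrow> a \<in> carrier A \<Longrightarrow> b \<in> carrier A \<Longrightarrow>
      dia A d (join A a b) = join A (dia A d a) (dia A d b)"

inductive_set generated :: "'m set \<Rightarrow> ('a, 'm) algebra \<Rightarrow> 'a set \<Rightarrow> 'a set"
  for M :: "'m set" and A :: "('a, 'm) algebra" and G :: "'a set" where
  gen: "a \<in> G \<Longrightarrow> a \<in> generated M A G"
| zero: "zero A \<in> generated M A G"
| one: "one A \<in> generated M A G"
| compl: "a \<in> generated M A G \<Longrightarrow> compl A a \<in> generated M A G"
| join: "a \<in> generated M A G \<Longrightarrow> b \<in> generated M A G \<Longrightarrow> join A a b \<in> generated M A G"
| dia: "d \<in> M \<Longrightarrow> a \<in> generated M A G \<Longrightarrow> dia A d a \<in> generated M A G"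

datatype (ops: 'm) tm =
    Var nat
  | Zero
  | One
  | Compl "'m tm"
  | Join "'m tm" "'m tm"
  | Oper 'm "'m tm"

definition terms :: "'m set \<Rightarrow> 'm tm set" where
  "terms M = {t. ops t \<subseteq> M}"

primrec eval :: "('a, 'm) algebra \<Rightarrow> (nat \<Rightarrow> 'a) \<Rightarrow> 'm tm \<Rightarrow> 'a" where
  "eval A v (Var k) = v k"
| "eval A v Zero = zero A"
| "eval A v One = one A"
| "eval A v (Compl t) = compl A (eval A v t)"
| "eval A v (Join s t) = join A (eval A v s) (eval A v t)"
| "eval A v (Oper d t) = dia A d (eval A v t)"

primrec translate :: "'m fm \<Rightarrow> 'm tm" where
  "translate (Atom k) = Var k"
| "translate Top = One"
| "translate (Neg \<phi>) = Compl (translate \<phi>)"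
| "translate (Or \<phi> \<psi>) = Join (translate \<phi>) (translate \<psi>)"
| "translate (Dia d \<phi>) = Oper d (translate \<phi>)"

definition satisfies :: "('a, 'm) algebra \<Rightarrow> 'm tm \<Rightarrow> 'm tm \<Rightarrow> bool" where
  "satisfies A s t \<longleftrightarrow> (\<forall>v. range v \<subseteq> carrier A \<longrightarrow> eval A v s = eval A v t)"

text \<open>A variety is a proper class, so it is represented by a set \<open>E\<close> of equations defining it:
  \<open>variety M E\<close>, at type \<open>('a, 'm) algebra set\<close>, consists of the members of the variety whose
  carrier is a set of elements of \<open>'a\<close>.  Notions quantifying over all members of the variety take
  the type \<open>'a\<close> as a parameter.\<close>

definition variety :: "'m set \<Rightarrow> ('m tm \<times> 'm tm) set \<Rightarrow> ('a, 'm) algebra set" where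
  "variety M E = {A. bao M A \<and> (\<forall>(s, t)\<in>E. satisfies A s t)}"

definition logic_of :: "'a itself \<Rightarrow> 'm set \<Rightarrow> ('m tm \<times> 'm tm) set \<Rightarrow> 'm fm set" where
  "logic_of _ M E =
     {\<phi> \<in> formulas M. \<forall>A \<in> (variety M E :: ('a, 'm) algebra set). satisfies A (translate \<phi>) One}"

definition ultrafilters :: "('a, 'm) algebra \<Rightarrow> 'a set set" where
  "ultrafilters A = {\<mu>. \<mu> \<subseteq> carrier A \<and> one A \<in> \<mu> \<and> zero A \<notin> \<mu> \<and>
     (\<forall>a\<in>\<mu>. \<forall>b\<in>\<mu>. meet A a b \<in> \<mu>) \<and>
     (\<forall>a\<in>\<mu>. \<forall>b\<in>carrier A. below A a b \<longrightarrow> b \<in> \<mu>) \<and>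
     (\<forall>a\<in>carrier A. a \<in> \<mu> \<or> compl A a \<in> \<mu>)}"

definition canonical_rel :: "('a, 'm) algebra \<Rightarrow> 'm \<Rightarrow> 'a set \<Rightarrow> 'a set \<Rightarrow> bool" where
  "canonical_rel A d \<mu> \<nu> \<longleftrightarrow> (\<forall>a\<in>\<nu>. dia A d a \<in> \<mu>)"

definition canonical_extension :: "('a, 'm) algebra \<Rightarrow> ('a set set, 'm) algebra" where
  "canonical_extension A =
     \<lparr>carrier = Pow (ultrafilters A),
      join = (\<union>),
      compl = (\<lambda>X. ultrafilters A - X),
      zero = {},
      one = ultrafilters A,
      dia = (\<lambda>d X. {\<mu> \<in> ultrafilters A. \<exists>\<nu>\<in>X. canonical_rel A d \<mu> \<nu>})\<rparr>"

text \<open>The cardinal \<open>\<kappa>\<close> is given as a cardinal order.  An algebra generated by at most \<open>\<kappa>\<close> elements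
  has at most \<open>\<kappa> + |M| + \<omega>\<close> elements, so \<open>canonical TYPE('a) \<kappa> M E\<close> expresses \<open>\<kappa>\<close>-canonicity
  whenever \<open>'a\<close> has at least that cardinality; for countable \<open>M\<close> and \<open>\<kappa> \<le> \<omega>\<close>, every infinite
  type will do.\<close>

definition canonical ::
  "'a itself \<Rightarrow> 'k rel \<Rightarrow> 'm set \<Rightarrow> ('m tm \<times> 'm tm) set \<Rightarrow> bool" where
  "canonical _ \<kappa> M E \<longleftrightarrow>
     (\<forall>A \<in> (variety M E :: ('a, 'm) algebra set).
        (\<exists>G. G \<subseteq> carrier A \<and> |G| \<le>o \<kappa> \<and> generated M A G = carrier A) \<longrightarrow>
        canonical_extension A \<in> variety M E)"

definition totally_canonical :: "'a itself \<Rightarrow> 'm set \<Rightarrow> ('m tm \<times> 'm tm) set \<Rightarrow> bool" where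
  "totally_canonical _ M E \<longleftrightarrow>
     (\<forall>A \<in> (variety M E :: ('a, 'm) algebra set). canonical_extension A \<in> variety M E)"

text \<open>Since a variable type is implicitly universally quantified, a disjunction
  \<open>totally_canonical TYPE('a) M E \<or> P\<close> in which \<open>P\<close> does not mention \<open>'a\<close> says that \<open>P\<close> holds
  unless the variety is totally canonical for algebras of every size.\<close>

end

theory Submission
  imports Defs "HOL-Library.Countable_Set_Type"
begin

text \<open>The theorem says that if the canonical extension of some member \<open>A\<close> of the variety violates an
equation \<open>s = t\<close>, then so does the canonical extension of some countable member. Let the equation
fail under \<open>v\<close> at the ultrafilter \<open>x\<close>. A Loewenheim-Skolem argument (\<open>countable_reflection\<close>) gives
a countable subalgebra \<open>C\<close> of \<open>A\<close> and a countable set \<open>X\<close> of ultrafilters of \<open>A\<close> with \<open>x \<in> X\<close>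
such that the pair of \<open>C\<close> and \<open>X\<close> reflects certain facts about \<open>A\<close> and its ultrafilters. The
ultrafilters in \<open>X\<close> leave traces on \<open>C\<close>, and on them truth is as in \<open>A\<close>. But
\<open>C\<close> has many further ultrafilters, and a valuation has to be chosen there without disturbing the
truth of any subterm of \<open>s\<close> and \<open>t\<close> at the traces.

Each ultrafilter \<open>w\<close> of \<open>C\<close> is therefore lifted to an ultrafilter of \<open>A\<close> above it and inherits its
valuation from there. By compactness the lift can be chosen in such a way that it stands to each
\<open>y \<in> X\<close> in the relations in which \<open>w\<close> stands to the trace of \<open>y\<close> (\<open>lifts_exists\<close>): it is a successor
of \<open>y\<close> if \<open>w\<close> is one of the trace of \<open>y\<close>, and inclusions between sets of successors persist.

It remains to show that truth at \<open>w\<close> is truth at the lift (\<open>truth_reflected\<close>), and only the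
diamonds are difficult. Here the width enters. Order the ultrafilters by inclusion of their sets of
successors, or equivalently by reverse inclusion of the sets of \<open>a\<close> with \<open>\<box>a\<close> in the ultrafilter.
The formulas in \<open>U\<close> say that the successors of one ultrafilter contain no antichain of more than
\<open>n\<close> elements (\<open>no_wide_antichain\<close>). Now let \<open>z\<close> be a successor of the trace of an element of \<open>X\<close>,
and consider the truth value of \<open>\<Diamond>r\<close> at the lift of \<open>z\<close>. There are two members of \<open>X\<close> at which
\<open>\<Diamond>r\<close> has the same truth value, the trace of one having at least, that of the other at most, the
successors of \<open>z\<close> (\<open>sandwich\<close>). The one with fewer successors provides a witness if \<open>\<Diamond>r\<close> is true, and the one
with more successors excludes every witness if \<open>\<Diamond>r\<close> is false.

The sandwich lemma is proved by contradiction. Choose a maximal antichain in \<open>X\<close> of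
elements incomparable with \<open>z\<close>; finitely many elements of \<open>C\<close> express this incomparability, and by maximality
every \<open>y \<in> X\<close> separated from the antichain in the same way is comparable with \<open>z\<close>, hence, as no
such \<open>y\<close> approximates \<open>z\<close> from the desired side, lies on the other side. The limit of all ultrafilters so separated is then realised by an ultrafilter in
\<open>X\<close> whose trace has the same successors as \<open>z\<close>. It has therefore the same successors as the lift of
\<open>z\<close>, and \<open>\<Diamond>r\<close> has the same truth value at both.\<close>

section \<open>Boolean calculus in an algebra with a carrier\<close>

context bao
begin

lemma closed [simp, intro]:
  "zero A \<in> carrier A" "one A \<in> carrier A"
  "a \<in> carrier A \<Longrightarrow> compl A a \<in> carrier A"
  "a \<in> carrier A \<Longrightarrow> b \<in> carrier A \<Longrightarrow> join A a b \<in> carrier A"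
  "d \<in> M \<Longrightarrow> a \<in> carrier A \<Longrightarrow> dia A d a \<in> carrier A"
  by (auto intro: zero_closed one_closed compl_closed join_closed dia_closed)

lemma meet_closed [simp, intro]:
  "a \<in> carrier A \<Longrightarrow> b \<in> carrier A \<Longrightarrow> meet A a b \<in> carrier A"
  by (simp add: meet_def)

lemma join_idem: assumes "a \<in> carrier A" shows "join A a a = a"
proof -
  have "a = join A a (meet A a (compl A a))" using assms by (simp add: meet_compl join_zero)
  also have "\<dots> = meet A (join A a a) (join A a (compl A a))" using assms by (simp add: join_meet_distrib)
  also have "\<dots> = join A a a" using assms by (simp add: join_compl meet_one)
  finally show ?thesis by simp
qed

lemma meet_idem: assumes "a \<in> carrier A" shows "meet A a a = a"
proof -
  have "a = meet A a (join A a (compl A a))" using assms by (simp add: join_compl meet_one)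
  also have "\<dots> = join A (meet A a a) (meet A a (compl A a))" using assms by (simp add: meet_join_distrib)
  also have "\<dots> = meet A a a" using assms by (simp add: meet_compl join_zero)
  finally show ?thesis by simp
qed

lemma join_one: assumes "a \<in> carrier A" shows "join A a (one A) = one A"
proof -
  have "join A a (join A a (compl A a)) = join A a (compl A a)"
    using assms by (simp add: join_assoc[symmetric] join_idem)
  then show ?thesis using assms by (simp add: join_compl)
qed

lemma meet_zero: assumes "a \<in> carrier A" shows "meet A a (zero A) = zero A"
proof -
  have "meet A a (meet A a (compl A a)) = meet A a (compl A a)"
    using assms by (simp add: meet_assoc[symmetric] meet_idem)
  then show ?thesis using assms by (simp add: meet_compl)
qed

lemma join_meet_absorb: assumes "a \<in> carrier A" "b \<in> carrier A" shows "join A (meet A a b) a = a"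
proof -
  have "join A (meet A a b) (meet A a (one A)) = meet A a (join A b (one A))"
    using assms by (simp add: meet_join_distrib)
  then show ?thesis using assms by (simp add: join_one meet_one)
qed

lemma compl_compl [simp]: assumes "a \<in> carrier A" shows "compl A (compl A a) = a"
proof -
  let ?b = "compl A a" let ?c = "compl A ?b"
  have "meet A a ?c = meet A a (join A ?b ?c)"
    using assms by (simp add: meet_join_distrib meet_compl join_zero join_comm[of "zero A"])
  then have 1: "meet A a ?c = a" using assms by (simp add: join_compl meet_one)
  have "meet A ?c a = meet A ?c (join A a ?b)"
    using assms by (simp add: meet_join_distrib meet_compl join_zero meet_comm[of ?c ?b])
  then have "meet A ?c a = ?c" using assms by (simp add: join_compl meet_one)
  then show ?thesis using 1 assms meet_comm[of a ?c] by simp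
qed

lemma below_meet1: "a \<in> carrier A \<Longrightarrow> b \<in> carrier A \<Longrightarrow> below A (meet A a b) a"
  by (simp add: below_def join_meet_absorb)

lemma below_meet2: "a \<in> carrier A \<Longrightarrow> b \<in> carrier A \<Longrightarrow> below A (meet A a b) b"
  using below_meet1[of b a] by (simp add: meet_comm)

lemma below_refl: "a \<in> carrier A \<Longrightarrow> below A a a"
  by (simp add: below_def join_idem)

lemma below_one: "a \<in> carrier A \<Longrightarrow> below A a (one A)"
  by (simp add: below_def join_one)

lemma below_trans:
  "below A a b \<Longrightarrow> below A b c \<Longrightarrow> a \<in> carrier A \<Longrightarrow> b \<in> carrier A \<Longrightarrow> c \<in> carrier A \<Longrightarrow> below A a c"
  unfolding below_def by (metis join_assoc)

lemma below_meetI: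
  "below A c a \<Longrightarrow> below A c b \<Longrightarrow> a \<in> carrier A \<Longrightarrow> b \<in> carrier A \<Longrightarrow> c \<in> carrier A \<Longrightarrow> below A c (meet A a b)"
  by (simp add: below_def join_meet_distrib)

lemma below_compl_if_disjoint:
  assumes "meet A f a = zero A" "a \<in> carrier A" "f \<in> carrier A"
  shows "below A f (compl A a)"
proof -
  have "meet A f (join A a (compl A a)) = meet A f (compl A a)"
    using assms by (simp add: meet_join_distrib join_comm[of "zero A"] join_zero del: join_compl)
  then have "f = meet A f (compl A a)" using assms by (simp add: join_compl meet_one)
  then show ?thesis using below_meet2[of f "compl A a"] assms by simp
qed

lemma below_zero_iff: "a \<in> carrier A \<Longrightarrow> below A a (zero A) \<Longrightarrow> a = zero A"
  by (simp add: below_def join_zero)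

end

section \<open>Ultrafilters and compactness\<close>

context bao
begin

lemma ultrafilterD:
  assumes "\<mu> \<in> ultrafilters A"
  shows "\<mu> \<subseteq> carrier A" "one A \<in> \<mu>" "zero A \<notin> \<mu>"
    "a \<in> \<mu> \<Longrightarrow> b \<in> \<mu> \<Longrightarrow> meet A a b \<in> \<mu>"
    "a \<in> \<mu> \<Longrightarrow> b \<in> carrier A \<Longrightarrow> below A a b \<Longrightarrow> b \<in> \<mu>"
    "a \<in> carrier A \<Longrightarrow> a \<in> \<mu> \<or> compl A a \<in> \<mu>"
  using assms unfolding ultrafilters_def by blast+

lemma compl_in_iff: "\<mu> \<in> ultrafilters A \<Longrightarrow> a \<in> carrier A \<Longrightarrow> compl A a \<in> \<mu> \<longleftrightarrow> a \<notin> \<mu>"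
  using ultrafilterD(3,6)[of \<mu>] ultrafilterD(4)[of \<mu> a "compl A a"] meet_compl[of a] by auto

lemma meet_in_iff:
  assumes "\<mu> \<in> ultrafilters A" "a \<in> carrier A" "b \<in> carrier A"
  shows "meet A a b \<in> \<mu> \<longleftrightarrow> a \<in> \<mu> \<and> b \<in> \<mu>"
  using assms below_meet1[of a b] below_meet2[of a b] ultrafilterD(4)[OF assms(1), of a b]
    ultrafilterD(5)[OF assms(1), of "meet A a b" a] ultrafilterD(5)[OF assms(1), of "meet A a b" b]
  by auto

lemma join_in_iff:
  assumes "\<mu> \<in> ultrafilters A" "a \<in> carrier A" "b \<in> carrier A"
  shows "join A a b \<in> \<mu> \<longleftrightarrow> a \<in> \<mu> \<or> b \<in> \<mu>"
proof -
  have "meet A (compl A a) (compl A b) \<in> \<mu> \<longleftrightarrow> a \<notin> \<mu> \<and> b \<notin> \<mu>"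
    using assms by (simp add: meet_in_iff compl_in_iff)
  moreover have "meet A (compl A a) (compl A b) = compl A (join A a b)"
    using assms by (simp add: meet_def)
  ultimately show ?thesis using assms compl_in_iff[of \<mu> "join A a b"] by auto
qed

lemma ultrafilter_subset_eq:
  assumes "\<mu> \<in> ultrafilters A" "\<nu> \<in> ultrafilters A" "\<mu> \<subseteq> \<nu>" shows "\<mu> = \<nu>"
proof
  show "\<nu> \<subseteq> \<mu>"
  proof
    fix a assume a: "a \<in> \<nu>"
    then have "a \<in> carrier A" using ultrafilterD(1)[OF assms(2)] by blast
    then show "a \<in> \<mu>"
      using a assms(3) compl_in_iff[OF assms(1), of a] compl_in_iff[OF assms(2), of a] by blast
  qed
qed (fact assms(3))

abbreviation meets :: "'a list \<Rightarrow> 'a" where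
  "meets xs \<equiv> foldr (meet A) xs (one A)"

lemma meets_closed: "set xs \<subseteq> carrier A \<Longrightarrow> meets xs \<in> carrier A"
  by (induction xs) auto

lemma meets_append_below:
  "set xs \<subseteq> carrier A \<Longrightarrow> set ys \<subseteq> carrier A \<Longrightarrow>
     below A (meets (xs @ ys)) (meets xs) \<and> below A (meets (xs @ ys)) (meets ys)"
proof (induction xs)
  case Nil
  then show ?case using meets_closed by (auto intro: below_one below_refl)
next
  case (Cons x xs)
  let ?m = "meets (xs @ ys)"
  have c: "x \<in> carrier A" "?m \<in> carrier A" "meets xs \<in> carrier A" "meets ys \<in> carrier A"
    using Cons.prems meets_closed[of "xs @ ys"] meets_closed by auto
  have "below A (meet A x ?m) x" "below A (meet A x ?m) ?m"
    using c by (auto intro: below_meet1 below_meet2)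
  then show ?case using Cons c
    by (auto intro!: below_meetI intro: below_trans[of _ ?m])
qed

lemma meets_in: "\<mu> \<in> ultrafilters A \<Longrightarrow> set xs \<subseteq> \<mu> \<Longrightarrow> meets xs \<in> \<mu>"
  by (induction xs) (auto intro: ultrafilterD(2,4))

text \<open>Zorn's lemma is applied to proper filters, of which the ultrafilters are the maximal ones.\<close>

definition filters :: "'a set set" where
  "filters = {F. F \<subseteq> carrier A \<and> one A \<in> F \<and> zero A \<notin> F \<and> (\<forall>a\<in>F. \<forall>b\<in>F. meet A a b \<in> F) \<and>
     (\<forall>a\<in>F. \<forall>b\<in>carrier A. below A a b \<longrightarrow> b \<in> F)}"

text \<open>The witness is the filter generated by \<open>F\<close> and \<open>a\<close>. It is proper because \<open>f \<and> a = 0\<close> with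
\<open>f \<in> F\<close> would put the complement of \<open>a\<close> above \<open>f\<close>.\<close>

lemma filter_extend:
  assumes F: "F \<in> filters" and a: "a \<in> carrier A" "compl A a \<notin> F"
  shows "\<exists>F'\<in>filters. F \<subseteq> F' \<and> a \<in> F'"
proof -
  let ?F = "{c \<in> carrier A. \<exists>f\<in>F. below A (meet A f a) c}"
  have sub: "F \<subseteq> carrier A" and one: "one A \<in> F" and
    meet: "\<And>a b. a \<in> F \<Longrightarrow> b \<in> F \<Longrightarrow> meet A a b \<in> F" and
    up: "\<And>a b. a \<in> F \<Longrightarrow> b \<in> carrier A \<Longrightarrow> below A a b \<Longrightarrow> b \<in> F"
    using F unfolding filters_def by blast+
  have "zero A \<notin> ?F"
  proof
    assume "zero A \<in> ?F"
    then obtain f where f: "f \<in> F" "below A (meet A f a) (zero A)" by blast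
    then have "below A f (compl A a)"
      using a sub below_zero_iff[of "meet A f a"] below_compl_if_disjoint[of f a] by blast
    then show False using a f up[of f "compl A a"] by simp
  qed
  moreover have "F \<subseteq> ?F" using sub a below_meet1 by blast
  moreover have "a \<in> ?F" using a below_meet2 one by blast
  moreover have "meet A c d \<in> ?F" if "c \<in> ?F" "d \<in> ?F" for c d
  proof -
    obtain f g where fg: "f \<in> F" "g \<in> F" "below A (meet A f a) c" "below A (meet A g a) d"
      using \<open>c \<in> ?F\<close> \<open>d \<in> ?F\<close> by auto
    let ?h = "meet A (meet A f g) a"
    have c: "f \<in> carrier A" "g \<in> carrier A" "c \<in> carrier A" "d \<in> carrier A" using fg sub that by auto
    have "below A ?h (meet A f g)" "below A ?h a" "below A (meet A f g) f" "below A (meet A f g) g"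
      using c a by (auto intro: below_meet1 below_meet2)
    then have "below A ?h (meet A f a)" "below A ?h (meet A g a)"
      using c a by (auto intro!: below_meetI intro: below_trans[of _ "meet A f g"])
    then have "below A ?h c" "below A ?h d"
      using below_trans[of ?h "meet A f a" c] below_trans[of ?h "meet A g a" d] c a fg(3,4) by auto
    then have "below A ?h (meet A c d)" using c a by (simp add: below_meetI)
    then show ?thesis using meet[OF fg(1,2)] c by auto
  qed
  moreover have "d \<in> ?F" if "c \<in> ?F" "d \<in> carrier A" "below A c d" for c d
  proof -
    obtain f where f: "f \<in> F" "below A (meet A f a) c" "c \<in> carrier A" using \<open>c \<in> ?F\<close> by auto
    then have "below A (meet A f a) d"
      using below_trans[of "meet A f a" c d] that a sub by auto
    then show ?thesis using f that by blast
  qed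
  moreover have "one A \<in> ?F" using \<open>F \<subseteq> ?F\<close> one by blast
  ultimately have "?F \<in> filters" unfolding filters_def by blast
  then show ?thesis using \<open>F \<subseteq> ?F\<close> \<open>a \<in> ?F\<close> by blast
qed

lemma filter_in_ultrafilter:
  assumes F: "F \<in> filters" shows "\<exists>\<mu>\<in>ultrafilters A. F \<subseteq> \<mu>"
proof -
  let ?P = "{G \<in> filters. F \<subseteq> G}"
  have "\<exists>m\<in>?P. \<forall>G\<in>?P. m \<subseteq> G \<longrightarrow> G = m"
  proof (rule subset_Zorn_nonempty)
    show "?P \<noteq> {}" using F by blast
  next
    fix \<C> assume C: "\<C> \<noteq> {}" "subset.chain ?P \<C>"
    have in_P: "G \<in> filters" "F \<subseteq> G" if "G \<in> \<C>" for G using C(2) that unfolding subset.chain_def by blast+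
    have "meet A a b \<in> \<Union>\<C>" if ab: "a \<in> \<Union>\<C>" "b \<in> \<Union>\<C>" for a b
    proof -
      obtain G H where GH: "G \<in> \<C>" "a \<in> G" "H \<in> \<C>" "b \<in> H" using ab by blast
      then have "G \<subseteq> H \<or> H \<subseteq> G" using C(2) unfolding subset.chain_def by blast
      moreover have "meet A c d \<in> K" if "K \<in> \<C>" "c \<in> K" "d \<in> K" for K c d
        using in_P(1)[OF that(1)] that(2,3) unfolding filters_def by blast
      ultimately show ?thesis using GH by blast
    qed
    moreover have "\<Union>\<C> \<subseteq> carrier A" "one A \<in> \<Union>\<C>" "zero A \<notin> \<Union>\<C>" "F \<subseteq> \<Union>\<C>"
      "\<forall>a\<in>\<Union>\<C>. \<forall>b\<in>carrier A. below A a b \<longrightarrow> b \<in> \<Union>\<C>"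
      using C(1) in_P unfolding filters_def by blast+
    ultimately show "\<Union>\<C> \<in> ?P" unfolding filters_def by blast
  qed
  then obtain m where m: "m \<in> filters" "F \<subseteq> m" "\<forall>G\<in>?P. m \<subseteq> G \<longrightarrow> G = m" by blast
  have "a \<in> m \<or> compl A a \<in> m" if "a \<in> carrier A" for a
    using filter_extend[OF m(1) that] m by blast
  then have "m \<in> ultrafilters A" using m(1) unfolding filters_def ultrafilters_def by blast
  then show ?thesis using m by blast
qed

lemma finite_meets_in_ultrafilter:
  assumes S: "S \<subseteq> carrier A" and fip: "\<And>xs. set xs \<subseteq> S \<Longrightarrow> meets xs \<noteq> zero A"
  shows "\<exists>\<mu>\<in>ultrafilters A. S \<subseteq> \<mu>"
proof -
  let ?F = "{c \<in> carrier A. \<exists>xs. set xs \<subseteq> S \<and> below A (meets xs) c}"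
  have mc: "meets xs \<in> carrier A" if "set xs \<subseteq> S" for xs using meets_closed that S by blast
  have "meet A a b \<in> ?F" if "a \<in> ?F" "b \<in> ?F" for a b
  proof -
    obtain xs ys where xy: "set xs \<subseteq> S" "below A (meets xs) a" "set ys \<subseteq> S" "below A (meets ys) b"
      and ab: "a \<in> carrier A" "b \<in> carrier A" using \<open>a \<in> ?F\<close> \<open>b \<in> ?F\<close> by auto
    have "below A (meets (xs @ ys)) a" "below A (meets (xs @ ys)) b"
      using xy ab mc[of xs] mc[of ys] mc[of "xs @ ys"] S meets_append_below[of xs ys]
        below_trans[of "meets (xs @ ys)" "meets xs" a] below_trans[of "meets (xs @ ys)" "meets ys" b]
      by auto
    then have "below A (meets (xs @ ys)) (meet A a b)"
      using ab mc[of "xs @ ys"] xy by (simp add: below_meetI)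
    then show ?thesis using ab xy by (metis (mono_tags, lifting) Un_least meet_closed mem_Collect_eq set_append)
  qed
  moreover have "one A \<in> ?F" using below_one[of "one A"] by (auto intro: exI[of _ "[]"])
  moreover have "zero A \<notin> ?F" using fip mc below_zero_iff by blast
  moreover have "b \<in> ?F" if "a \<in> ?F" "b \<in> carrier A" "below A a b" for a b
  proof -
    obtain xs where "set xs \<subseteq> S" "below A (meets xs) a" "a \<in> carrier A" using \<open>a \<in> ?F\<close> by auto
    then show ?thesis using that below_trans[of "meets xs" a b] mc[of xs] by auto
  qed
  ultimately have "?F \<in> filters" unfolding filters_def by blast
  moreover have "S \<subseteq> ?F"
  proof
    fix a assume "a \<in> S"
    then show "a \<in> ?F" using S below_meet1[of a "one A"] by (auto intro!: exI[of _ "[a]"])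
  qed
  ultimately show ?thesis by (meson filter_in_ultrafilter order_trans)
qed

text \<open>Compactness of the Stone space. In this form the uses below need no computation with finite
meets: to realise a set of requirements it suffices to point out an ultrafilter for each finite part.\<close>

lemma compactness:
  assumes "S \<subseteq> carrier A" and "\<And>Y. finite Y \<Longrightarrow> Y \<subseteq> S \<Longrightarrow> \<exists>\<mu>\<in>ultrafilters A. Y \<subseteq> \<mu>"
  shows "\<exists>\<mu>\<in>ultrafilters A. S \<subseteq> \<mu>"
  using assms(1)
proof (rule finite_meets_in_ultrafilter)
  fix xs assume "set xs \<subseteq> S"
  then obtain \<mu> where "\<mu> \<in> ultrafilters A" "set xs \<subseteq> \<mu>" using assms(2)[of "set xs"] by auto
  then show "meets xs \<noteq> zero A" using meets_in[of \<mu> xs] ultrafilterD(3)[of \<mu>] by auto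
qed

end

section \<open>Box types of ultrafilters and finite achronal width\<close>

definition box :: "('a, 'm) algebra \<Rightarrow> 'm \<Rightarrow> 'a \<Rightarrow> 'a" where
  "box A d a = compl A (dia A d (compl A a))"

text \<open>The set \<open>boxes A d True \<mu>\<close> determines which ultrafilters are \<open>d\<close>-successors of \<open>\<mu>\<close>, and a larger
set means fewer successors. Its complement \<open>boxes A d False \<mu>\<close> is given the same status because
the approximations from above and from below in the order by successors are then instances of one
statement with parameter \<open>e\<close>.\<close>

definition boxes :: "('a, 'm) algebra \<Rightarrow> 'm \<Rightarrow> bool \<Rightarrow> 'a set \<Rightarrow> 'a set" where
  "boxes A d e \<mu> = {a \<in> carrier A. (box A d a \<in> \<mu>) = e}"

definition signed_box :: "('a, 'm) algebra \<Rightarrow> 'm \<Rightarrow> bool \<Rightarrow> 'a \<Rightarrow> 'a" where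
  "signed_box A d e a = (if e then box A d a else compl A (box A d a))"

lemma boxes_False: "boxes A d False \<mu> = carrier A - boxes A d True \<mu>"
  by (auto simp: boxes_def)

lemma boxes_eqI: "boxes A d e \<mu> = boxes A d e \<nu> \<Longrightarrow> boxes A d e' \<mu> = boxes A d e' \<nu>"
  by (cases e; cases e'; auto simp: boxes_def)

context bao
begin

lemma box_closed [simp, intro]: "d \<in> M \<Longrightarrow> a \<in> carrier A \<Longrightarrow> box A d a \<in> carrier A"
  by (simp add: box_def)

lemma signed_box_closed [simp, intro]: "d \<in> M \<Longrightarrow> a \<in> carrier A \<Longrightarrow> signed_box A d e a \<in> carrier A"
  by (simp add: signed_box_def)

lemma signed_box_in_iff:
  "\<mu> \<in> ultrafilters A \<Longrightarrow> d \<in> M \<Longrightarrow> a \<in> carrier A \<Longrightarrow> signed_box A d e a \<in> \<mu> \<longleftrightarrow> a \<in> boxes A d e \<mu>"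
  by (auto simp: signed_box_def boxes_def compl_in_iff)

lemma canonical_rel_iff:
  assumes \<mu>: "\<mu> \<in> ultrafilters A" and \<nu>: "\<nu> \<in> ultrafilters A" and d: "d \<in> M"
  shows "canonical_rel A d \<mu> \<nu> \<longleftrightarrow> boxes A d True \<mu> \<subseteq> \<nu>"
proof
  assume R: "canonical_rel A d \<mu> \<nu>"
  show "boxes A d True \<mu> \<subseteq> \<nu>"
  proof
    fix a assume "a \<in> boxes A d True \<mu>"
    then have a: "a \<in> carrier A" "dia A d (compl A a) \<notin> \<mu>"
      using \<mu> d by (auto simp: boxes_def box_def compl_in_iff)
    then have "compl A a \<notin> \<nu>" using R unfolding canonical_rel_def by blast
    then show "a \<in> \<nu>" using a \<nu> compl_in_iff[of \<nu> a] by blast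
  qed
next
  assume sub: "boxes A d True \<mu> \<subseteq> \<nu>"
  show "canonical_rel A d \<mu> \<nu>"
    unfolding canonical_rel_def
  proof (rule ballI, rule ccontr)
    fix a assume a: "a \<in> \<nu>" "dia A d a \<notin> \<mu>"
    have ac: "a \<in> carrier A" using a ultrafilterD(1)[OF \<nu>] by blast
    then have "compl A a \<in> boxes A d True \<mu>"
      using a d \<mu> by (simp add: boxes_def box_def compl_in_iff)
    then show False using sub ac a(1) compl_in_iff[OF \<nu>, of a] by blast
  qed
qed

lemma box_meet:
  assumes "d \<in> M" "a \<in> carrier A" "b \<in> carrier A"
  shows "box A d (meet A a b) = meet A (box A d a) (box A d b)"
  using assms by (simp add: box_def meet_def dia_join)

lemma meet_in_boxes_iff:
  assumes "\<mu> \<in> ultrafilters A" "d \<in> M" "a \<in> carrier A" "b \<in> carrier A"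
  shows "meet A a b \<in> boxes A d True \<mu> \<longleftrightarrow> a \<in> boxes A d True \<mu> \<and> b \<in> boxes A d True \<mu>"
  using assms by (simp add: boxes_def box_meet meet_in_iff)

text \<open>The sets \<open>boxes A d True \<nu>\<close> are filters, so the meet of separating elements, one for each
\<open>\<nu> \<in> N\<close>, separates \<open>\<mu>\<close> from all of \<open>N\<close> at once.\<close>

lemma boxes_common_separator:
  assumes \<mu>: "\<mu> \<in> ultrafilters A" and d: "d \<in> M" and "finite N"
    and "\<And>\<nu>. \<nu> \<in> N \<Longrightarrow> \<nu> \<in> ultrafilters A \<and> \<not> boxes A d True \<mu> \<subseteq> boxes A d True \<nu>"
  shows "\<exists>a\<in>boxes A d True \<mu>. \<forall>\<nu>\<in>N. a \<notin> boxes A d True \<nu>"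
  using assms(3,4)
proof (induction N rule: finite_induct)
  case empty
  have "box A d (one A) \<in> \<mu>"
  proof -
    have "compl A (one A) = zero A" using meet_compl[of "one A"] meet_one[of "compl A (one A)"]
        meet_comm[of "one A" "compl A (one A)"] by simp
    then show ?thesis using \<mu> d compl_in_iff[OF \<mu>, of "zero A"] ultrafilterD(3)[OF \<mu>]
      by (simp add: box_def dia_zero)
  qed
  then show ?case by (auto simp: boxes_def)
next
  case (insert \<nu> N)
  then obtain a where a: "a \<in> boxes A d True \<mu>" "\<forall>\<nu>\<in>N. a \<notin> boxes A d True \<nu>" by auto
  obtain b where b: "b \<in> boxes A d True \<mu>" "b \<notin> boxes A d True \<nu>" using insert.prems[of \<nu>] by auto
  have ab: "a \<in> carrier A" "b \<in> carrier A" using a b by (auto simp: boxes_def)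
  have "meet A a b \<in> boxes A d True \<mu>" using a(1) b(1) ab \<mu> d by (simp add: meet_in_boxes_iff)
  moreover have "meet A a b \<notin> boxes A d True \<nu>'" if "\<nu>' \<in> insert \<nu> N" for \<nu>'
    using that insert.prems[OF that] a(2) b(2) ab d meet_in_boxes_iff[of \<nu>' d a b] by auto
  ultimately show ?case by blast
qed

lemma eval_closed:
  "range v \<subseteq> carrier A \<Longrightarrow> ops t \<subseteq> M \<Longrightarrow> eval A v t \<in> carrier A"
  by (induction t) auto

lemma eval_Disj_in_iff:
  assumes \<mu>: "\<mu> \<in> ultrafilters A"
  shows "\<forall>\<phi>\<in>set \<phi>s. eval A v (translate \<phi>) \<in> carrier A \<Longrightarrow>
    eval A v (translate (Disj \<phi>s)) \<in> carrier A \<and>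
    (eval A v (translate (Disj \<phi>s)) \<in> \<mu> \<longleftrightarrow> (\<exists>\<phi>\<in>set \<phi>s. eval A v (translate \<phi>) \<in> \<mu>))"
proof (induction \<phi>s rule: Disj.induct)
  case 1
  then show ?case using compl_in_iff[OF \<mu>, of "one A"] ultrafilterD(2)[OF \<mu>] by simp
next
  case (3 \<phi> \<psi> \<phi>s)
  then show ?case using join_in_iff[OF \<mu>] by simp
qed simp

lemma eval_Box: "eval A v (translate (Box d \<phi>)) = box A d (eval A v (translate \<phi>))"
  by (simp add: Box_def box_def)

lemma eval_Imp_in_iff:
  assumes "\<mu> \<in> ultrafilters A" "eval A v (translate \<phi>) \<in> carrier A" "eval A v (translate \<psi>) \<in> carrier A"
  shows "eval A v (translate (Imp \<phi> \<psi>)) \<in> \<mu> \<longleftrightarrow>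
    (eval A v (translate \<phi>) \<in> \<mu> \<longrightarrow> eval A v (translate \<psi>) \<in> \<mu>)"
  using assms by (simp add: Imp_def join_in_iff compl_in_iff)

text \<open>If \<open>\<nu>\<^sub>0, \<dots>, \<nu>\<^sub>n\<close> were successors of \<open>x\<close> forming an antichain, interpret the \<open>i\<close>-th atom by an
element that is boxed in \<open>\<nu>\<^sub>i\<close> and in no other \<open>\<nu>\<^sub>j\<close>. Then \<open>\<nu>\<^sub>i\<close> refutes the implication in the
\<open>i\<close>-th disjunct, so every disjunct fails at \<open>x\<close>.\<close>

lemma no_wide_antichain:
  assumes valid: "satisfies A (translate (U_formula n d d')) One" and d: "d \<in> M" "d' \<in> M"
    and x: "x \<in> ultrafilters A" and N: "finite N" "n < card N"
    and succ: "\<And>\<nu>. \<nu> \<in> N \<Longrightarrow> \<nu> \<in> ultrafilters A \<and> canonical_rel A d x \<nu>"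
    and anti: "\<And>\<mu> \<nu>. \<mu> \<in> N \<Longrightarrow> \<nu> \<in> N \<Longrightarrow> \<mu> \<noteq> \<nu> \<Longrightarrow> \<not> boxes A d' True \<mu> \<subseteq> boxes A d' True \<nu>"
  shows False
proof -
  obtain N' where N': "N' \<subseteq> N" "card N' = Suc n" using N by (meson Suc_leI obtain_subset_with_card_n)
  have "finite N'" using N N' finite_subset by blast
  then obtain h where h: "bij_betw h {0..<Suc n} N'" using N'(2) ex_bij_betw_nat_finite by metis
  have hN: "h i \<in> N" if "i \<le> n" for i
    using bij_betw_apply[OF h, of i] that N'(1) by auto
  have h_inj: "h i \<noteq> h j" if "i \<le> n" "j \<le> n" "i \<noteq> j" for i j
    using bij_betw_imp_inj_on[OF h] that unfolding inj_on_def by fastforce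
  have "\<exists>a\<in>boxes A d' True \<mu>. \<forall>\<nu>\<in>N - {\<mu>}. a \<notin> boxes A d' True \<nu>" if "\<mu> \<in> N" for \<mu>
    by (rule boxes_common_separator) (use that d succ anti N in auto)
  then obtain a where a: "\<And>\<mu>. \<mu> \<in> N \<Longrightarrow> a \<mu> \<in> boxes A d' True \<mu>"
    "\<And>\<mu> \<nu>. \<mu> \<in> N \<Longrightarrow> \<nu> \<in> N \<Longrightarrow> \<nu> \<noteq> \<mu> \<Longrightarrow> a \<mu> \<notin> boxes A d' True \<nu>" by (metis DiffI singletonD)
  define v where "v k = (if k \<le> n then a (h k) else one A)" for k
  have vc: "v k \<in> carrier A" for k using a(1)[OF hN] by (auto simp: v_def boxes_def)
  have v_in: "box A d' (v j) \<in> h i \<longleftrightarrow> j = i" if "i \<le> n" "j \<le> n" for i j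
    using that a(1)[OF hN[of i]] a(2)[OF hN[of j] hN[of i]] h_inj[of i j] vc[of j]
    by (auto simp: v_def boxes_def)
  let ?others = "\<lambda>i. map (\<lambda>j. Box d' (Atom j)) (filter (\<lambda>j. j \<noteq> i) [0..<Suc n])"
  let ?clause = "\<lambda>i. Imp (Box d' (Atom i)) (Disj (?others i))"
  have atom: "eval A v (translate (Box d' (Atom j))) = box A d' (v j)" for j by (simp add: eval_Box)
  have others: "eval A v (translate (Disj (?others i))) \<in> carrier A \<and>
      (eval A v (translate (Disj (?others i))) \<in> h k \<longleftrightarrow> (\<exists>j. j \<le> n \<and> j \<noteq> i \<and> box A d' (v j) \<in> h k))"
    if "k \<le> n" for i k
    using eval_Disj_in_iff[of "h k" "?others i" v] succ[OF hN[OF that]] vc d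
    by (auto simp: atom less_Suc_eq_le simp del: upt_Suc)
  have clause_closed: "eval A v (translate (?clause i)) \<in> carrier A" for i
    using others[of 0 i] vc d by (simp add: Imp_def atom del: upt_Suc)
  have "eval A v (translate (?clause i)) \<notin> h i" if "i \<le> n" for i
    using eval_Imp_in_iff[of "h i" v "Box d' (Atom i)" "Disj (?others i)"] succ[OF hN[OF that]]
      others[OF that, of i] vc d v_in[OF that] that
    by (auto simp: atom simp del: upt_Suc)
  then have "eval A v (translate (Box d (?clause i))) \<notin> x" if "i \<le> n" for i
    using that succ[OF hN[OF that]] canonical_rel_iff[OF x, of "h i" d] d clause_closed[of i]
    by (auto simp: eval_Box boxes_def simp del: upt_Suc)
  then have "eval A v (translate (U_formula n d d')) \<notin> x"
    unfolding U_formula_def using eval_Disj_in_iff[OF x, of "map (\<lambda>i. Box d (?clause i)) [0..<Suc n]" v] clause_closed d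
    by (auto simp: eval_Box less_Suc_eq_le simp del: upt_Suc)
  moreover have "eval A v (translate (U_formula n d d')) = one A"
    using valid vc unfolding satisfies_def by auto
  ultimately show False using ultrafilterD(2)[OF x] by simp
qed

end

lemma U_formula_in_logic:
  assumes "KU n M \<subseteq> logic_of TYPE('b) M E" and "d \<in> M" "d' \<in> M"
    and "(A :: ('b, 'm) algebra) \<in> variety M E"
  shows "satisfies A (translate (U_formula n d d')) One"
proof -
  have "U_formula n d d' \<in> KU n M" using assms(2,3) unfolding KU_def U_def by blast
  then show ?thesis using assms(1,4) unfolding logic_of_def by blast
qed

lemma canonical_extension_bao: "bao M (canonical_extension A)"
  by standard (auto simp: canonical_extension_def meet_def)

section \<open>Subalgebras and traces of ultrafilters\<close>

text \<open>The subalgebra is represented by an injective homomorphism \<open>g\<close>, since it has to live on a type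
other than that of \<open>A\<close>.\<close>

locale embedding = A: bao M A
  for M :: "'m set" and A :: "('a, 'm) algebra" +
  fixes C :: "('c, 'm) algebra" and g :: "'c \<Rightarrow> 'a"
  assumes C_closed: "zero C \<in> carrier C" "one C \<in> carrier C"
      "b \<in> carrier C \<Longrightarrow> compl C b \<in> carrier C"
      "b \<in> carrier C \<Longrightarrow> c \<in> carrier C \<Longrightarrow> join C b c \<in> carrier C"
      "d \<in> M \<Longrightarrow> b \<in> carrier C \<Longrightarrow> dia C d b \<in> carrier C"
    and g_inj: "inj_on g (carrier C)"
    and g_closed: "b \<in> carrier C \<Longrightarrow> g b \<in> carrier A"
    and g_hom: "g (zero C) = zero A" "g (one C) = one A"
      "b \<in> carrier C \<Longrightarrow> g (compl C b) = compl A (g b)"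
      "b \<in> carrier C \<Longrightarrow> c \<in> carrier C \<Longrightarrow> g (join C b c) = join A (g b) (g c)"
      "d \<in> M \<Longrightarrow> b \<in> carrier C \<Longrightarrow> g (dia C d b) = dia A d (g b)"
begin

lemma g_eq: "b \<in> carrier C \<Longrightarrow> c \<in> carrier C \<Longrightarrow> g b = g c \<Longrightarrow> b = c"
  using g_inj by (auto dest: inj_onD)

lemma g_meet:
  "b \<in> carrier C \<Longrightarrow> c \<in> carrier C \<Longrightarrow> meet C b c \<in> carrier C \<and> g (meet C b c) = meet A (g b) (g c)"
  by (simp add: meet_def C_closed g_hom)

lemma subalgebra_bao: "bao M C"
proof
  fix a b c d
  show "dia C d (zero C) = zero C" if "d \<in> M"
    using that by (intro g_eq) (simp_all add: C_closed g_closed g_hom A.dia_zero)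
  show "dia C d (join C a b) = join C (dia C d a) (dia C d b)"
    if "d \<in> M" "a \<in> carrier C" "b \<in> carrier C"
    using that by (intro g_eq) (simp_all add: C_closed g_closed g_hom A.dia_join)
  show "join C (join C a b) c = join C a (join C b c)"
    if "a \<in> carrier C" "b \<in> carrier C" "c \<in> carrier C"
    using that by (intro g_eq) (simp_all add: C_closed g_closed g_hom A.join_assoc)
  show "meet C (meet C a b) c = meet C a (meet C b c)"
    if "a \<in> carrier C" "b \<in> carrier C" "c \<in> carrier C"
    using that by (intro g_eq) (simp_all add: C_closed g_closed g_hom g_meet A.meet_assoc)
  show "join C a b = join C b a" if "a \<in> carrier C" "b \<in> carrier C"
    using that by (intro g_eq) (simp_all add: C_closed g_closed g_hom A.join_comm[of "g a"])
  show "meet C a b = meet C b a" if "a \<in> carrier C" "b \<in> carrier C"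
    using that by (intro g_eq) (simp_all add: C_closed g_closed g_hom g_meet A.meet_comm[of "g a"])
  show "meet C a (join C b c) = join C (meet C a b) (meet C a c)"
    if "a \<in> carrier C" "b \<in> carrier C" "c \<in> carrier C"
    using that by (intro g_eq) (simp_all add: C_closed g_closed g_hom g_meet A.meet_join_distrib)
  show "join C a (meet C b c) = meet C (join C a b) (join C a c)"
    if "a \<in> carrier C" "b \<in> carrier C" "c \<in> carrier C"
    using that by (intro g_eq) (simp_all add: C_closed g_closed g_hom g_meet A.join_meet_distrib)
  show "meet C a (one C) = a" if "a \<in> carrier C"
    using that by (intro g_eq) (simp_all add: C_closed g_closed g_hom g_meet A.meet_one)
  show "join C a (zero C) = a" if "a \<in> carrier C"
    using that by (intro g_eq) (simp_all add: C_closed g_closed g_hom A.join_zero)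
  show "meet C a (compl C a) = zero C" if "a \<in> carrier C"
    using that by (intro g_eq) (simp_all add: C_closed g_closed g_hom g_meet A.meet_compl)
  show "join C a (compl C a) = one C" if "a \<in> carrier C"
    using that by (intro g_eq) (simp_all add: C_closed g_closed g_hom A.join_compl)
qed (fact C_closed)+

sublocale C: bao M C by (rule subalgebra_bao)

lemma g_eval:
  "range v \<subseteq> carrier C \<Longrightarrow> ops t \<subseteq> M \<Longrightarrow> g (eval C v t) = eval A (g \<circ> v) t"
  by (induction t) (use C.eval_closed[of v] in \<open>auto simp: g_hom\<close>)

lemma subalgebra_in_variety:
  assumes "A \<in> variety M E" and "E \<subseteq> terms M \<times> terms M"
  shows "C \<in> variety M E"
proof -
  have "satisfies C s t" if st: "(s, t) \<in> E" for s t
    unfolding satisfies_def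
  proof (intro allI impI)
    fix v :: "nat \<Rightarrow> 'c" assume v: "range v \<subseteq> carrier C"
    have ops: "ops s \<subseteq> M" "ops t \<subseteq> M" using assms(2) st unfolding terms_def by auto
    have "range (g \<circ> v) \<subseteq> carrier A" using v g_closed by auto
    then have "eval A (g \<circ> v) s = eval A (g \<circ> v) t"
      using assms(1) st unfolding variety_def satisfies_def by blast
    then have "g (eval C v s) = g (eval C v t)" using v ops by (simp add: g_eval)
    then show "eval C v s = eval C v t" using v ops by (intro g_eq) (auto simp: C.eval_closed)
  qed
  then show ?thesis using subalgebra_bao unfolding variety_def by blast
qed

definition trace :: "'a set \<Rightarrow> 'c set" where
  "trace \<mu> = {b \<in> carrier C. g b \<in> \<mu>}"

lemma trace_ultrafilter: assumes "\<mu> \<in> ultrafilters A" shows "trace \<mu> \<in> ultrafilters C"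
proof -
  note U = A.ultrafilterD[OF assms]
  have "b \<in> trace \<mu>" if b: "a \<in> trace \<mu>" "b \<in> carrier C" "below C a b" for a b
  proof -
    have "a \<in> carrier C" "g a \<in> \<mu>" using b unfolding trace_def by auto
    then have "below A (g a) (g b)" using b(2,3) g_hom(4)[of a b] by (simp add: below_def)
    then show ?thesis using U(5)[of "g a" "g b"] b(2) g_closed \<open>g a \<in> \<mu>\<close> by (simp add: trace_def)
  qed
  moreover have "meet C a b \<in> trace \<mu>" if "a \<in> trace \<mu>" "b \<in> trace \<mu>" for a b
    using that g_meet[of a b] U(4)[of "g a" "g b"] by (simp add: trace_def)
  moreover have "a \<in> trace \<mu> \<or> compl C a \<in> trace \<mu>" if "a \<in> carrier C" for a
    using that U(6)[of "g a"] g_closed by (simp add: trace_def g_hom)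
  moreover have "one C \<in> trace \<mu>" "zero C \<notin> trace \<mu>" "trace \<mu> \<subseteq> carrier C"
    using U(2,3) by (auto simp: trace_def g_hom)
  ultimately show ?thesis unfolding ultrafilters_def by blast
qed

lemma g_box: "d \<in> M \<Longrightarrow> b \<in> carrier C \<Longrightarrow> g (box C d b) = box A d (g b)"
  by (simp add: box_def g_hom)

lemma g_signed_box: "d \<in> M \<Longrightarrow> b \<in> carrier C \<Longrightarrow> g (signed_box C d e b) = signed_box A d e (g b)"
  by (simp add: signed_box_def g_box g_hom)

lemma boxes_trace_iff:
  "d \<in> M \<Longrightarrow> b \<in> carrier C \<Longrightarrow> b \<in> boxes C d e (trace \<mu>) \<longleftrightarrow> g b \<in> boxes A d e \<mu>"
  by (auto simp: boxes_def trace_def g_box g_closed)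

text \<open>The set \<open>g ` w\<close> has the finite meet property, because \<open>g\<close> commutes with meets and maps only
zero to zero.\<close>

lemma ultrafilter_extends:
  assumes w: "w \<in> ultrafilters C"
  shows "\<exists>\<mu>\<in>ultrafilters A. g ` w \<subseteq> \<mu>"
proof (rule A.finite_meets_in_ultrafilter)
  have wc: "w \<subseteq> carrier C" using C.ultrafilterD(1)[OF w] .
  then show "g ` w \<subseteq> carrier A" using g_closed by auto
  have lift: "\<exists>ys. set ys \<subseteq> w \<and> g (C.meets ys) = A.meets xs" if "set xs \<subseteq> g ` w" for xs
    using that
  proof (induction xs)
    case Nil
    then show ?case by (auto simp: g_hom intro: exI[of _ "[]"])
  next
    case (Cons x xs)
    then obtain y ys where y: "y \<in> w" "x = g y" "set ys \<subseteq> w" "g (C.meets ys) = A.meets xs" by auto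
    then have "g (meet C y (C.meets ys)) = A.meets (x # xs)"
      using g_meet[of y "C.meets ys"] wc C.meets_closed[of ys] by auto
    then show ?case using y by (auto intro!: exI[of _ "y # ys"])
  qed
  fix xs assume "set xs \<subseteq> g ` w"
  then obtain ys where ys: "set ys \<subseteq> w" "g (C.meets ys) = A.meets xs" using lift by blast
  then have "C.meets ys \<in> w" using C.meets_in[OF w] by blast
  then show "A.meets xs \<noteq> zero A"
    using ys C.ultrafilterD(3)[OF w] g_hom(1) g_eq[of "C.meets ys" "zero C"] wc by auto
qed

end

section \<open>Countable reflection\<close>

text \<open>Each \<open>R \<in> \<R>\<close> stands for an existential statement \<open>\<exists>cs ys. R bs xs cs ys\<close> with parameters \<open>bs\<close> and
\<open>xs\<close> of two sorts. The pair of \<open>B\<close> and \<open>X\<close> plays the role of an elementary substructure of the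
pair of \<open>CA\<close> and \<open>CX\<close>, but only for these statements.\<close>

definition reflects ::
  "('a list \<Rightarrow> 'x list \<Rightarrow> 'a list \<Rightarrow> 'x list \<Rightarrow> bool) set \<Rightarrow> 'a set \<Rightarrow> 'x set \<Rightarrow> 'a set \<Rightarrow> 'x set \<Rightarrow> bool" where
  "reflects \<R> CA CX B X \<longleftrightarrow>
     (\<forall>R\<in>\<R>. \<forall>bs\<in>lists B. \<forall>xs\<in>lists X.
        (\<exists>cs\<in>lists CA. \<exists>ys\<in>lists CX. R bs xs cs ys) \<longrightarrow> (\<exists>cs\<in>lists B. \<exists>ys\<in>lists X. R bs xs cs ys))"

lemma set_subset_increasing_UN:
  assumes "set xs \<subseteq> (\<Union>k::nat. L k)" and "\<And>k. L k \<subseteq> L (Suc k)"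
  shows "\<exists>k. \<forall>m\<ge>k. set xs \<subseteq> L m"
  using assms(1)
proof (induction xs)
  case (Cons x xs)
  then obtain k l where k: "x \<in> L k" and l: "\<forall>m\<ge>l. set xs \<subseteq> L m" by auto
  have "L k \<subseteq> L m" if "k \<le> m" for m by (rule lift_Suc_mono_le[of L, OF assms(2) that])
  then have "\<forall>m\<ge>max k l. set (x # xs) \<subseteq> L m" using k l by auto
  then show ?case by blast
qed simp

text \<open>The Loewenheim-Skolem construction: close \<open>X0\<close> under Skolem functions in \<open>\<omega>\<close> steps. There are
countably many statements and, at each step, countably many finite lists of parameters.\<close>

lemma countable_reflection:
  fixes \<R> :: "('a list \<Rightarrow> 'x list \<Rightarrow> 'a list \<Rightarrow> 'x list \<Rightarrow> bool) set"
  assumes "countable \<R>" and "countable X0" "X0 \<subseteq> CX"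
  obtains B X where "B \<subseteq> CA" "countable B" "X0 \<subseteq> X" "X \<subseteq> CX" "countable X" "reflects \<R> CA CX B X"
proof -
  define sk where "sk R bs xs =
    (SOME (cs, ys). cs \<in> lists CA \<and> ys \<in> lists CX \<and> R bs xs cs ys)" for R :: "'a list \<Rightarrow> 'x list \<Rightarrow> 'a list \<Rightarrow> 'x list \<Rightarrow> bool" and bs xs
  have sk: "fst (sk R bs xs) \<in> lists CA \<and> snd (sk R bs xs) \<in> lists CX \<and> R bs xs (fst (sk R bs xs)) (snd (sk R bs xs))"
    if "cs \<in> lists CA" "ys \<in> lists CX" "R bs xs cs ys" for R bs xs cs ys
    unfolding sk_def case_prod_beta by (rule someI[of _ "(cs, ys)"]) (use that in simp)
  define step where "step = (\<lambda>(B, X).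
    (B \<union> CA \<inter> (\<Union>R\<in>\<R>. \<Union>bs\<in>lists B. \<Union>xs\<in>lists X. set (fst (sk R bs xs))),
     X \<union> CX \<inter> (\<Union>R\<in>\<R>. \<Union>bs\<in>lists B. \<Union>xs\<in>lists X. set (snd (sk R bs xs)))))"
  define B where "B k = fst ((step ^^ k) ({}, X0))" for k
  define X where "X k = snd ((step ^^ k) ({}, X0))" for k
  have base: "B 0 = {}" "X 0 = X0" by (simp_all add: B_def X_def)
  have B_Suc: "B (Suc k) = B k \<union> CA \<inter> (\<Union>R\<in>\<R>. \<Union>bs\<in>lists (B k). \<Union>xs\<in>lists (X k). set (fst (sk R bs xs)))"
    and X_Suc: "X (Suc k) = X k \<union> CX \<inter> (\<Union>R\<in>\<R>. \<Union>bs\<in>lists (B k). \<Union>xs\<in>lists (X k). set (snd (sk R bs xs)))" for k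
    by (simp_all add: B_def X_def step_def case_prod_beta)
  have sub: "B k \<subseteq> CA \<and> X k \<subseteq> CX \<and> countable (B k) \<and> countable (X k)" for k
  proof (induction k)
    case 0
    then show ?case using assms(2,3) by (simp add: base)
  next
    case (Suc k)
    then have "countable (lists (B k))" "countable (lists (X k))" by auto
    then show ?case using Suc assms(1) unfolding B_Suc X_Suc
      by (auto intro!: countable_Un countable_Int2 countable_UN intro: countable_finite)
  qed
  have "reflects \<R> CA CX (\<Union>k. B k) (\<Union>k. X k)"
    unfolding reflects_def
  proof (intro ballI impI)
    fix R bs xs
    assume R: "R \<in> \<R>" and bs: "bs \<in> lists (\<Union>k. B k)" and xs: "xs \<in> lists (\<Union>k. X k)"
      and "\<exists>cs\<in>lists CA. \<exists>ys\<in>lists CX. R bs xs cs ys"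
    then have w: "fst (sk R bs xs) \<in> lists CA" "snd (sk R bs xs) \<in> lists CX"
      "R bs xs (fst (sk R bs xs)) (snd (sk R bs xs))" using sk by blast+
    have bs_sub: "set bs \<subseteq> (\<Union>k. B k)" and xs_sub: "set xs \<subseteq> (\<Union>k. X k)" using bs xs by auto
    have incr: "B k \<subseteq> B (Suc k)" "X k \<subseteq> X (Suc k)" for k by (simp_all add: B_Suc X_Suc)
    obtain k where k: "\<forall>m\<ge>k. set bs \<subseteq> B m"
      using set_subset_increasing_UN[OF bs_sub incr(1)] by blast
    obtain l where l: "\<forall>m\<ge>l. set xs \<subseteq> X m"
      using set_subset_increasing_UN[OF xs_sub incr(2)] by blast
    define m where "m = max k l"
    have "bs \<in> lists (B m)" "xs \<in> lists (X m)" using k l by (simp_all add: m_def lists_eq_set)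
    then have "set (fst (sk R bs xs)) \<subseteq> B (Suc m)" "set (snd (sk R bs xs)) \<subseteq> X (Suc m)"
      using w(1,2) R unfolding B_Suc X_Suc in_lists_conv_set by blast+
    then have "fst (sk R bs xs) \<in> lists (\<Union>k. B k)" "snd (sk R bs xs) \<in> lists (\<Union>k. X k)" by auto
    then show "\<exists>cs\<in>lists (\<Union>k. B k). \<exists>ys\<in>lists (\<Union>k. X k). R bs xs cs ys" using w(3) by blast
  qed
  moreover have "X0 \<subseteq> (\<Union>k. X k)" using base(2) by blast
  ultimately show ?thesis using that[of "\<Union>k. B k" "\<Union>k. X k"] sub by auto
qed

section \<open>The facts that are reflected\<close>

text \<open>The two sorts are the elements of an algebra and its ultrafilters.\<close>

type_synonym 'a requirement = "'a list \<Rightarrow> 'a set list \<Rightarrow> 'a list \<Rightarrow> 'a set list \<Rightarrow> bool"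

definition op_rel :: "('a list \<Rightarrow> 'a) \<Rightarrow> 'a requirement" where
  "op_rel f bs xs cs ys \<longleftrightarrow> cs = [f bs] \<and> ys = []"

definition operations :: "'m set \<Rightarrow> ('a, 'm) algebra \<Rightarrow> ('a list \<Rightarrow> 'a) set" where
  "operations M A = {\<lambda>_. zero A, \<lambda>_. one A, \<lambda>bs. compl A (hd bs), \<lambda>bs. join A (hd bs) (bs ! 1)} \<union>
     (\<lambda>d bs. dia A d (hd bs)) ` M"

text \<open>A probe \<open>(h, K)\<close> yields for an ultrafilter \<open>x\<close> the set \<open>h ` K x\<close> of elements, and a condition on an
ultrafilter \<open>\<mu>\<close>, namely that \<open>\<mu>\<close> contain this set. The probes express that \<open>\<mu> = x\<close>, that \<open>\<mu>\<close> is a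
\<open>d\<close>-successor of \<open>x\<close>, and that \<open>boxes A d e x \<subseteq> boxes A d e \<mu>\<close>.\<close>

definition probes :: "'m set \<Rightarrow> ('a, 'm) algebra \<Rightarrow> (('a \<Rightarrow> 'a) \<times> ('a set \<Rightarrow> 'a set)) set" where
  "probes M A = {(id, id)} \<union> (\<lambda>d. (id, boxes A d True)) ` M \<union>
     (\<lambda>(d, e). (signed_box A d e, boxes A d e)) ` (M \<times> UNIV)"

text \<open>The elements \<open>cs\<close> show that no ultrafilter contains \<open>bs\<close> and satisfies the conditions expressed by
the probes \<open>hs\<close> at the ultrafilters \<open>xs\<close>. Reflecting this gives the finite consistency
needed for lifting ultrafilters.\<close>

definition refuting ::
  "('a, 'm) algebra \<Rightarrow> (('a \<Rightarrow> 'a) \<times> ('a set \<Rightarrow> 'a set)) list \<Rightarrow> 'a requirement" where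
  "refuting A hs bs xs cs ys \<longleftrightarrow> ys = [] \<and> length xs = length hs \<and> length cs = length hs \<and>
     (\<forall>i<length hs. cs ! i \<in> snd (hs ! i) (xs ! i)) \<and>
     \<not> (\<exists>\<mu>\<in>ultrafilters A. set bs \<subseteq> \<mu> \<and> (\<forall>i<length hs. fst (hs ! i) (cs ! i) \<in> \<mu>))"

text \<open>The successors of \<open>x\<close> in \<open>S\<close> for which the status of the boxes of \<open>bs\<close> is prescribed by \<open>\<sigma>\<close>. With
a suitable choice of \<open>bs\<close> and \<open>\<sigma>\<close> these are the successors separated from a given
finite antichain.\<close>

definition cell ::
  "('a, 'm) algebra \<Rightarrow> 'm \<Rightarrow> 'm \<Rightarrow> 'a set set \<Rightarrow> bool list \<Rightarrow> 'a set \<Rightarrow> 'a list \<Rightarrow> 'a set set" where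
  "cell A d d' S \<sigma> x bs = {u \<in> ultrafilters A. canonical_rel A d x u \<and> u \<in> S \<and>
     list_all2 (\<lambda>b e. b \<in> boxes A d' e u) bs \<sigma>}"

definition populating ::
  "('a, 'm) algebra \<Rightarrow> 'm \<Rightarrow> 'm \<Rightarrow> 'a set set \<Rightarrow> bool list \<Rightarrow> 'a requirement" where
  "populating A d d' S \<sigma> bs xs cs ys \<longleftrightarrow>
     (\<exists>x u. xs = [x] \<and> cs = [] \<and> ys = [u] \<and> u \<in> cell A d d' S \<sigma> x bs)"

text \<open>The sets \<open>boxes A d' e u\<close> for \<open>u\<close> in the cell fail to be directed: no single one contains the
finite set of all members of \<open>cs\<close>.\<close>

definition spreading ::
  "('a, 'm) algebra \<Rightarrow> 'm \<Rightarrow> 'm \<Rightarrow> 'a set set \<Rightarrow> bool list \<Rightarrow> bool \<Rightarrow> 'a requirement" where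
  "spreading A d d' S \<sigma> e bs xs cs ys \<longleftrightarrow>
     (\<exists>x. xs = [x] \<and> ys = [] \<and> set cs \<subseteq> (\<Union>u\<in>cell A d d' S \<sigma> x bs. boxes A d' e u) \<and>
       \<not> (\<exists>u\<in>cell A d d' S \<sigma> x bs. set cs \<subseteq> boxes A d' e u))"

text \<open>The ultrafilter \<open>u\<close> is a limit of the cell: an element counts for \<open>u\<close> if it counts for some
member. For \<open>e = False\<close> the union says that an element is boxed in \<open>u\<close> if and only if it is boxed in
every member.\<close>

definition limiting ::
  "('a, 'm) algebra \<Rightarrow> 'm \<Rightarrow> 'm \<Rightarrow> 'a set set \<Rightarrow> bool list \<Rightarrow> bool \<Rightarrow> 'a requirement" where
  "limiting A d d' S \<sigma> e bs xs cs ys \<longleftrightarrow>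
     (\<exists>x u. xs = [x] \<and> cs = [] \<and> ys = [u] \<and> canonical_rel A d x u \<and>
       boxes A d' e u = (\<Union>u\<in>cell A d d' S \<sigma> x bs. boxes A d' e u))"

definition reflected_rels ::
  "'m set \<Rightarrow> ('a, 'm) algebra \<Rightarrow> 'a set set set \<Rightarrow> 'a requirement set" where
  "reflected_rels M A \<S> = op_rel ` operations M A \<union> refuting A ` lists (probes M A) \<union>
     (\<lambda>(d, d', S, \<sigma>). populating A d d' S \<sigma>) ` (M \<times> M \<times> \<S> \<times> UNIV) \<union>
     (\<lambda>(d, d', S, \<sigma>, e). spreading A d d' S \<sigma> e) ` (M \<times> M \<times> \<S> \<times> UNIV \<times> UNIV) \<union>
     (\<lambda>(d, d', S, \<sigma>, e). limiting A d d' S \<sigma> e) ` (M \<times> M \<times> \<S> \<times> UNIV \<times> UNIV)"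

lemma reflected_relsI:
  assumes "d \<in> M" "d' \<in> M" "S \<in> \<S>"
  shows "populating A d d' S \<sigma> \<in> reflected_rels M A \<S>" (is ?P)
    and "spreading A d d' S \<sigma> e \<in> reflected_rels M A \<S>" (is ?S)
    and "limiting A d d' S \<sigma> e \<in> reflected_rels M A \<S>" (is ?L)
proof -
  have "populating A d d' S \<sigma> \<in> (\<lambda>(d, d', S, \<sigma>). populating A d d' S \<sigma>) ` (M \<times> M \<times> \<S> \<times> UNIV)"
    by (rule image_eqI[of _ _ "(d, d', S, \<sigma>)"]) (use assms in simp_all)
  then show ?P unfolding reflected_rels_def by (simp only: Un_iff simp_thms)
  have "spreading A d d' S \<sigma> e \<in> (\<lambda>(d, d', S, \<sigma>, e). spreading A d d' S \<sigma> e) ` (M \<times> M \<times> \<S> \<times> UNIV \<times> UNIV)"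
    by (rule image_eqI[of _ _ "(d, d', S, \<sigma>, e)"]) (use assms in simp_all)
  then show ?S unfolding reflected_rels_def by (simp only: Un_iff simp_thms)
  have "limiting A d d' S \<sigma> e \<in> (\<lambda>(d, d', S, \<sigma>, e). limiting A d d' S \<sigma> e) ` (M \<times> M \<times> \<S> \<times> UNIV \<times> UNIV)"
    by (rule image_eqI[of _ _ "(d, d', S, \<sigma>, e)"]) (use assms in simp_all)
  then show ?L unfolding reflected_rels_def by (simp only: Un_iff simp_thms)
qed

lemma countable_reflected_rels:
  assumes "countable M" "countable \<S>"
  shows "countable (reflected_rels M A \<S>)"
  using assms unfolding reflected_rels_def probes_def operations_def
  by (intro countable_Un countable_image countable_lists countable_SIGMA countable_insert) auto

text \<open>In the application \<open>\<S>\<close> consists of the truth sets of the subterms of the refuted equation, of their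
complements, and of the set of all ultrafilters.\<close>

locale reflecting_subalgebra = embedding M A C g
  for M :: "'m set" and A :: "('a, 'm) algebra" and C :: "('c, 'm) algebra" and g :: "'c \<Rightarrow> 'a" +
  fixes X :: "'a set set" and \<S> :: "'a set set set"
  assumes X_sub: "X \<subseteq> ultrafilters A"
    and reflects: "reflects (reflected_rels M A \<S>) (carrier A) (ultrafilters A) (g ` carrier C) X"
begin

lemma X_ultra: "x \<in> X \<Longrightarrow> x \<in> ultrafilters A" using X_sub by blast

lemma reflect:
  assumes "R \<in> reflected_rels M A \<S>" "set bs \<subseteq> g ` carrier C" "set xs \<subseteq> X" "R bs xs cs ys"
    "set cs \<subseteq> carrier A" "set ys \<subseteq> ultrafilters A"
  shows "\<exists>cs ys. set cs \<subseteq> g ` carrier C \<and> set ys \<subseteq> X \<and> R bs xs cs ys"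
proof -
  have "bs \<in> lists (g ` carrier C)" "xs \<in> lists X" "cs \<in> lists (carrier A)" "ys \<in> lists (ultrafilters A)"
    using assms by auto
  then have "\<exists>cs\<in>lists (g ` carrier C). \<exists>ys\<in>lists X. R bs xs cs ys"
    using reflects assms(1,4) unfolding reflects_def by blast
  then show ?thesis by (auto simp: in_lists_conv_set subset_iff)
qed

lemma reflect_refuting:
  assumes "set hs \<subseteq> probes M A" "set bs \<subseteq> g ` carrier C" "set xs \<subseteq> X" "set cs \<subseteq> carrier A"
    "refuting A hs bs xs cs []"
  shows "\<exists>cs. set cs \<subseteq> g ` carrier C \<and> refuting A hs bs xs cs []"
proof -
  have R: "refuting A hs \<in> reflected_rels M A \<S>" using assms(1) unfolding reflected_rels_def by blast
  obtain cs ys where "set cs \<subseteq> g ` carrier C" "refuting A hs bs xs cs ys"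
    using reflect[OF R assms(2,3,5,4)] by auto
  then show ?thesis by (auto simp: refuting_def)
qed

lemma reflect_populating:
  assumes "d \<in> M" "d' \<in> M" "S \<in> \<S>" "set bs \<subseteq> g ` carrier C" "x \<in> X" "u \<in> cell A d d' S \<sigma> x bs"
  shows "\<exists>y\<in>X. y \<in> cell A d d' S \<sigma> x bs"
proof -
  note R = reflected_relsI(1)[OF assms(1-3), where A = A and \<sigma> = \<sigma>]
  have "populating A d d' S \<sigma> bs [x] [] [u]" using assms(6) by (simp add: populating_def)
  moreover have "u \<in> ultrafilters A" using assms(6) by (simp add: cell_def)
  ultimately obtain cs ys where "set ys \<subseteq> X" "populating A d d' S \<sigma> bs [x] cs ys"
    using reflect[OF R assms(4), of "[x]" "[]" "[u]"] assms(5) by auto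
  then show ?thesis by (auto simp: populating_def)
qed

lemma reflect_spreading:
  assumes "d \<in> M" "d' \<in> M" "S \<in> \<S>" "set bs \<subseteq> g ` carrier C" "x \<in> X" "set cs \<subseteq> carrier A"
    "spreading A d d' S \<sigma> e bs [x] cs []"
  shows "\<exists>cs. set cs \<subseteq> g ` carrier C \<and> spreading A d d' S \<sigma> e bs [x] cs []"
proof -
  note R = reflected_relsI(2)[OF assms(1-3), where A = A and \<sigma> = \<sigma> and e = e]
  obtain cs ys where "set cs \<subseteq> g ` carrier C" "spreading A d d' S \<sigma> e bs [x] cs ys"
    using reflect[OF R assms(4) _ assms(7,6)] assms(5) by auto
  then show ?thesis by (auto simp: spreading_def)
qed

lemma reflect_limiting:
  assumes "d \<in> M" "d' \<in> M" "S \<in> \<S>" "set bs \<subseteq> g ` carrier C" "x \<in> X" "u \<in> ultrafilters A"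
    "canonical_rel A d x u" "boxes A d' e u = (\<Union>u\<in>cell A d d' S \<sigma> x bs. boxes A d' e u)"
  shows "\<exists>y\<in>X. canonical_rel A d x y \<and> boxes A d' e y = (\<Union>u\<in>cell A d d' S \<sigma> x bs. boxes A d' e u)"
proof -
  note R = reflected_relsI(3)[OF assms(1-3), where A = A and \<sigma> = \<sigma> and e = e]
  have "limiting A d d' S \<sigma> e bs [x] [] [u]" using assms(7,8) by (simp add: limiting_def)
  then obtain cs ys where "set ys \<subseteq> X" "limiting A d d' S \<sigma> e bs [x] cs ys"
    using reflect[OF R assms(4), of "[x]" "[]" "[u]"] assms(5,6) by auto
  then show ?thesis by (auto simp: limiting_def)
qed

section \<open>Lifting ultrafilters of the subalgebra\<close>

text \<open>Every condition expressed by a probe at some \<open>x \<in> X\<close> that \<open>w\<close> satisfies as far as the subalgebra can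
see has to be satisfied by \<open>\<mu>\<close> in full.\<close>

definition lifts :: "'c set \<Rightarrow> 'a set \<Rightarrow> bool" where
  "lifts w \<mu> \<longleftrightarrow> \<mu> \<in> ultrafilters A \<and> trace \<mu> = w \<and>
     (\<forall>(h, K)\<in>probes M A. \<forall>x\<in>X. h ` (K x \<inter> g ` carrier C) \<subseteq> g ` w \<longrightarrow> h ` K x \<subseteq> \<mu>)"

lemma probe_closed:
  "(h, K) \<in> probes M A \<Longrightarrow> x \<in> X \<Longrightarrow> c \<in> K x \<Longrightarrow> c \<in> carrier A \<and> h c \<in> carrier A"
  using A.ultrafilterD(1)[OF X_ultra, of x]
  by (auto simp: probes_def boxes_def)

text \<open>By compactness it is enough to satisfy finitely many requirements. If finitely many were
inconsistent, then by reflection the elements exhibiting the inconsistency could be taken from the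
subalgebra. But then they belong to \<open>w\<close>, and \<open>w\<close> extends to an ultrafilter.\<close>

lemma lifts_exists:
  assumes w: "w \<in> ultrafilters C"
  shows "\<exists>\<mu>. lifts w \<mu>"
proof -
  define P where "P = {(h, K, x, c). (h, K) \<in> probes M A \<and> x \<in> X \<and> c \<in> K x \<and> h ` (K x \<inter> g ` carrier C) \<subseteq> g ` w}"
  let ?T = "g ` w \<union> (\<lambda>(h, K, x, c). h c) ` P"
  have wc: "w \<subseteq> carrier C" using C.ultrafilterD(1)[OF w] .
  have "\<exists>\<mu>\<in>ultrafilters A. ?T \<subseteq> \<mu>"
  proof (rule A.compactness)
    show "?T \<subseteq> carrier A" using wc g_closed probe_closed by (auto simp: P_def)
  next
    fix Y assume Y: "finite Y" "Y \<subseteq> ?T"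
    \<comment> \<open>The elements of \<open>Y\<close> in \<open>g ` w\<close> serve as parameters, each of the others comes from a probe.\<close>
    obtain bs where bs: "set bs = Y \<inter> g ` w" using Y(1) finite_list[of "Y \<inter> g ` w"] by auto
    have "finite (Y - g ` w)" "Y - g ` w \<subseteq> (\<lambda>(h, K, x, c). h c) ` P" using Y by auto
    then obtain Q where "Q \<subseteq> P" "finite Q" "Y - g ` w = (\<lambda>(h, K, x, c). h c) ` Q"
      by (meson finite_subset_image)
    then obtain qs where qs: "set qs \<subseteq> P" "Y - g ` w = (\<lambda>(h, K, x, c). h c) ` set qs"
      using finite_list by metis
    define hs where "hs = map (\<lambda>(h, K, x, c). (h, K)) qs"
    define xs where "xs = map (\<lambda>(h, K, x, c). x) qs"
    define cs where "cs = map (\<lambda>(h, K, x, c). c) qs"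
    have len: "length hs = length qs" "length xs = length qs" "length cs = length qs"
      by (simp_all add: hs_def xs_def cs_def)
    have nth: "(hs ! i) \<in> probes M A \<and> xs ! i \<in> X \<and> cs ! i \<in> snd (hs ! i) (xs ! i) \<and>
        fst (hs ! i) ` (snd (hs ! i) (xs ! i) \<inter> g ` carrier C) \<subseteq> g ` w \<and>
        (case qs ! i of (h, K, x, c) \<Rightarrow> h c) = fst (hs ! i) (cs ! i)" if "i < length qs" for i
    proof -
      obtain h K x c where q: "qs ! i = (h, K, x, c)" by (cases "qs ! i") auto
      then have "(h, K, x, c) \<in> P" using qs(1) nth_mem[OF that] by auto
      then show ?thesis using that q by (simp add: hs_def xs_def cs_def P_def)
    qed
    show "\<exists>\<mu>\<in>ultrafilters A. Y \<subseteq> \<mu>"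
    proof (rule ccontr)
      assume none: "\<not> ?thesis"
      have "refuting A hs bs xs cs []"
        unfolding refuting_def
      proof (intro conjI notI)
        assume "\<exists>\<mu>\<in>ultrafilters A. set bs \<subseteq> \<mu> \<and> (\<forall>i<length hs. fst (hs ! i) (cs ! i) \<in> \<mu>)"
        then obtain \<mu> where \<mu>: "\<mu> \<in> ultrafilters A" "set bs \<subseteq> \<mu>" "\<And>i. i < length qs \<Longrightarrow> fst (hs ! i) (cs ! i) \<in> \<mu>"
          using len by auto
        have "Y - g ` w \<subseteq> \<mu>"
        proof
          fix y assume "y \<in> Y - g ` w"
          then obtain q where "q \<in> set qs" "y = (case q of (h, K, x, c) \<Rightarrow> h c)" unfolding qs(2) by blast
          then obtain i where "i < length qs" "y = (case qs ! i of (h, K, x, c) \<Rightarrow> h c)"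
            by (auto simp: in_set_conv_nth)
          then show "y \<in> \<mu>" using nth[of i] \<mu>(3)[of i] by simp
        qed
        moreover have "Y \<inter> g ` w \<subseteq> \<mu>" using \<mu>(2) bs by simp
        ultimately have "Y \<subseteq> \<mu>" by blast
        then show False using none \<mu>(1) by blast
      qed (use len nth in auto)
      moreover have "set hs \<subseteq> probes M A" "set xs \<subseteq> X" "set cs \<subseteq> carrier A"
        using qs(1) probe_closed by (fastforce simp: hs_def xs_def cs_def P_def)+
      ultimately obtain cs' where cs': "set cs' \<subseteq> g ` carrier C" "refuting A hs bs xs cs' []"
        using reflect_refuting[of hs bs xs cs] bs wc by blast
      obtain \<mu> where \<mu>: "\<mu> \<in> ultrafilters A" "g ` w \<subseteq> \<mu>" using ultrafilter_extends[OF w] by blast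
      have "fst (hs ! i) (cs' ! i) \<in> \<mu>" if i: "i < length hs" for i
      proof -
        have "cs' ! i \<in> snd (hs ! i) (xs ! i) \<inter> g ` carrier C"
          using cs' i unfolding refuting_def by (metis IntI nth_mem subsetD)
        moreover have "fst (hs ! i) ` (snd (hs ! i) (xs ! i) \<inter> g ` carrier C) \<subseteq> g ` w"
          using nth[of i] i len(1) by simp
        ultimately have "fst (hs ! i) (cs' ! i) \<in> g ` w" by (rule subsetD[OF _ imageI, rotated])
        then show ?thesis using \<mu>(2) by (rule subsetD[rotated])
      qed
      moreover have "set bs \<subseteq> \<mu>" using \<mu>(2) bs by auto
      ultimately show False using cs'(2) \<mu>(1) unfolding refuting_def by blast
    qed
  qed
  then obtain \<mu> where \<mu>: "\<mu> \<in> ultrafilters A" "?T \<subseteq> \<mu>" by blast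
  have "w \<subseteq> trace \<mu>" using \<mu>(2) wc by (auto simp: trace_def)
  then have "trace \<mu> = w" using C.ultrafilter_subset_eq[OF w trace_ultrafilter[OF \<mu>(1)]] by blast
  moreover have "h ` K x \<subseteq> \<mu>" if "(h, K) \<in> probes M A" "x \<in> X" "h ` (K x \<inter> g ` carrier C) \<subseteq> g ` w" for h K x
  proof
    fix y assume "y \<in> h ` K x"
    then obtain c where "c \<in> K x" "y = h c" by blast
    then have "(h, K, x, c) \<in> P" using that by (simp add: P_def)
    then show "y \<in> \<mu>" using \<mu>(2) \<open>y = h c\<close> by force
  qed
  ultimately show ?thesis using \<mu>(1) unfolding lifts_def by blast
qed

lemma lifts_trace: assumes "x \<in> X" "lifts (trace x) \<mu>" shows "\<mu> = x"
proof -
  have "(id, id) \<in> probes M A" by (simp add: probes_def)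
  moreover have "id ` (id x \<inter> g ` carrier C) \<subseteq> g ` trace x" by (auto simp: trace_def)
  ultimately have "x \<subseteq> \<mu>" using assms unfolding lifts_def by fastforce
  then show ?thesis using A.ultrafilter_subset_eq[OF X_ultra[OF assms(1)]] assms(2) unfolding lifts_def by blast
qed

lemma lifts_successor:
  assumes "lifts w \<mu>" "d \<in> M" "x \<in> X" "boxes C d True (trace x) \<subseteq> w"
  shows "canonical_rel A d x \<mu>"
proof -
  have "(id, boxes A d True) \<in> probes M A" using assms(2) by (auto simp: probes_def)
  moreover have "id ` (boxes A d True x \<inter> g ` carrier C) \<subseteq> g ` w"
    using assms(2,4) boxes_trace_iff[of d _ True x] by auto
  ultimately have "boxes A d True x \<subseteq> \<mu>" using assms(1,3) unfolding lifts_def by fastforce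
  moreover have "\<mu> \<in> ultrafilters A" using assms(1) by (simp add: lifts_def)
  ultimately show ?thesis using A.canonical_rel_iff[OF X_ultra[OF assms(3)] _ assms(2)] by blast
qed

lemma lifts_boxes:
  assumes l: "lifts w \<mu>" and "d \<in> M" "x \<in> X" "boxes C d e (trace x) \<subseteq> boxes C d e w"
  shows "boxes A d e x \<subseteq> boxes A d e \<mu>"
proof -
  have \<mu>: "\<mu> \<in> ultrafilters A" and w: "trace \<mu> = w" using l unfolding lifts_def by auto
  have w_ultra: "w \<in> ultrafilters C" using trace_ultrafilter[OF \<mu>] w by simp
  have "(signed_box A d e, boxes A d e) \<in> probes M A" using assms(2) by (auto simp: probes_def)
  moreover have "signed_box A d e ` (boxes A d e x \<inter> g ` carrier C) \<subseteq> g ` w"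
  proof clarify
    fix b assume b: "b \<in> carrier C" "g b \<in> boxes A d e x"
    then have "b \<in> boxes C d e w" using assms(2,4) boxes_trace_iff[of d b e x] by blast
    then have "signed_box C d e b \<in> w" using C.signed_box_in_iff[OF w_ultra] assms(2) b by blast
    then show "signed_box A d e (g b) \<in> g ` w" using g_signed_box[OF assms(2) b(1), of e] by force
  qed
  ultimately have "signed_box A d e ` boxes A d e x \<subseteq> \<mu>" using l assms(3) unfolding lifts_def by fastforce
  moreover have "a \<in> carrier A" if "a \<in> boxes A d e x" for a using that by (simp add: boxes_def)
  ultimately show ?thesis using A.signed_box_in_iff[OF \<mu> assms(2)] by blast
qed

section \<open>Approximation by reflected ultrafilters\<close>

text \<open>Compactness again: a member \<open>u\<close> of the cell satisfies any finite part of the positive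
requirements by directedness, and all the negative ones because \<open>boxes A d' e u\<close> is contained in
the union.\<close>

lemma cell_limit:
  assumes M: "d \<in> M" "d' \<in> M" and x: "x \<in> ultrafilters A"
    and dir: "\<And>as. set as \<subseteq> (\<Union>u\<in>cell A d d' S \<sigma> x bs. boxes A d' e u) \<Longrightarrow>
      \<exists>u\<in>cell A d d' S \<sigma> x bs. set as \<subseteq> boxes A d' e u"
  shows "\<exists>u\<in>ultrafilters A. canonical_rel A d x u \<and>
    boxes A d' e u = (\<Union>u\<in>cell A d d' S \<sigma> x bs. boxes A d' e u)"
proof -
  let ?cell = "cell A d d' S \<sigma> x bs"
  define F where "F = (\<Union>u\<in>?cell. boxes A d' e u)"
  have F_sub: "F \<subseteq> carrier A" by (auto simp: F_def boxes_def)
  let ?T = "boxes A d True x \<union> signed_box A d' e ` F \<union> signed_box A d' (\<not> e) ` (carrier A - F)"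
  have "\<exists>\<mu>\<in>ultrafilters A. ?T \<subseteq> \<mu>"
  proof (rule A.compactness)
    show "?T \<subseteq> carrier A" using F_sub M by (auto simp: boxes_def)
  next
    fix Y assume Y: "finite Y" "Y \<subseteq> ?T"
    then have "finite (Y \<inter> signed_box A d' e ` F)" by blast
    then obtain D where D: "D \<subseteq> F" "finite D" "Y \<inter> signed_box A d' e ` F = signed_box A d' e ` D"
      by (meson finite_subset_image Int_lower2)
    then obtain as where as: "set as = D" using finite_list by blast
    then obtain u where u: "u \<in> ?cell" "D \<subseteq> boxes A d' e u" using dir[of as] D(1) unfolding F_def by blast
    have U: "u \<in> ultrafilters A" and R: "canonical_rel A d x u" using u(1) by (auto simp: cell_def)
    have Du: "signed_box A d' e ` D \<subseteq> u" using u(2) A.signed_box_in_iff[OF U M(2)] D(1) F_sub by blast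
    have nFu: "signed_box A d' (\<not> e) ` (carrier A - F) \<subseteq> u"
    proof clarify
      fix a assume "a \<in> carrier A" "a \<notin> F"
      then have "a \<in> boxes A d' (\<not> e) u" using u(1) by (auto simp: F_def boxes_def)
      then show "signed_box A d' (\<not> e) a \<in> u" using A.signed_box_in_iff[OF U M(2) \<open>a \<in> carrier A\<close>] by blast
    qed
    have xu: "boxes A d True x \<subseteq> u" using R A.canonical_rel_iff[OF x U M(1)] by blast
    have Fu: "Y \<inter> signed_box A d' e ` F \<subseteq> u" unfolding D(3) by (rule Du)
    have "Y \<subseteq> u" if "Y \<subseteq> P1 \<union> P2 \<union> P3" "P1 \<subseteq> u" "Y \<inter> P2 \<subseteq> u" "P3 \<subseteq> u" for P1 P2 P3
      using that by blast
    from this[OF Y(2) xu Fu nFu] have "Y \<subseteq> u" .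
    then show "\<exists>\<mu>\<in>ultrafilters A. Y \<subseteq> \<mu>" using U by blast
  qed
  then obtain \<mu> where \<mu>: "\<mu> \<in> ultrafilters A" "?T \<subseteq> \<mu>" by blast
  have "canonical_rel A d x \<mu>" using A.canonical_rel_iff[OF x \<mu>(1) M(1)] \<mu>(2) by blast
  moreover have "boxes A d' e \<mu> = F"
  proof
    show "F \<subseteq> boxes A d' e \<mu>" using \<mu>(2) A.signed_box_in_iff[OF \<mu>(1) M(2)] F_sub by blast
    show "boxes A d' e \<mu> \<subseteq> F"
    proof
      fix a assume a: "a \<in> boxes A d' e \<mu>"
      then have "a \<in> carrier A" "a \<notin> boxes A d' (\<not> e) \<mu>" by (auto simp: boxes_def)
      then show "a \<in> F" using \<mu>(2) A.signed_box_in_iff[OF \<mu>(1) M(2), of a "\<not> e"] by blast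
    qed
  qed
  ultimately show ?thesis using \<mu>(1) unfolding F_def by blast
qed

text \<open>This is where the bounded width is used. The required invariance of \<open>S\<close> under having the same
\<open>d'\<close>-successors holds for the truth set of a diamond and for its complement. The
two values of \<open>e\<close> give approximations of \<open>z\<close> from the two sides.\<close>

lemma sandwich:
  assumes M: "d \<in> M" "d' \<in> M" and S: "S \<in> \<S>"
    and S_sat: "\<And>u u'. u \<in> ultrafilters A \<Longrightarrow> u' \<in> ultrafilters A \<Longrightarrow>
      boxes A d' True u = boxes A d' True u' \<Longrightarrow> u \<in> S \<Longrightarrow> u' \<in> S"
    and valid: "satisfies C (translate (U_formula n d d')) One"
    and x: "x \<in> X" and z: "z \<in> ultrafilters C" "canonical_rel C d (trace x) z"
    and \<mu>: "lifts z \<mu>" "\<mu> \<in> S"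
  shows "\<exists>y\<in>X. y \<in> S \<and> boxes C d' e z \<subseteq> boxes C d' e (trace y)"
proof (rule ccontr)
  assume none: "\<not> ?thesis"
  have \<mu>_ultra: "\<mu> \<in> ultrafilters A" and \<mu>_trace: "trace \<mu> = z" using \<mu> unfolding lifts_def by auto
  have x_ultra: "x \<in> ultrafilters A" and tx: "trace x \<in> ultrafilters C"
    using X_ultra[OF x] trace_ultrafilter by auto
  have x\<mu>: "canonical_rel A d x \<mu>"
    using lifts_successor[OF \<mu>(1) M(1) x] z(2) C.canonical_rel_iff[OF tx z(1) M(1)] by blast
  define bx where "bx w = boxes C d' True w" for w
  define anti where "anti Q \<longleftrightarrow> finite Q \<and> Q \<subseteq> {y \<in> X. y \<in> S \<and> canonical_rel A d x y} \<and>
    (\<forall>y\<in>insert z (trace ` Q). \<forall>y'\<in>insert z (trace ` Q). y \<noteq> y' \<longrightarrow> \<not> bx y \<subseteq> bx y') \<and>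
    inj_on trace Q \<and> z \<notin> trace ` Q" for Q
  have trace_rel: "canonical_rel C d (trace x) (trace y)" if "y \<in> X" "canonical_rel A d x y" for y
  proof -
    have "boxes C d True (trace x) \<subseteq> trace y"
      using that A.canonical_rel_iff[OF x_ultra X_ultra M(1), of y] boxes_trace_iff[OF M(1), of _ True x]
      by (fastforce simp: trace_def boxes_def)
    then show ?thesis using C.canonical_rel_iff[OF tx trace_ultrafilter[OF X_ultra] M(1)] that by blast
  qed
  \<comment> \<open>Adding \<open>z\<close> itself to the traces gives an antichain of one more element among the
    successors of the trace of \<open>x\<close>.\<close>
  have bound: "card Q < n" if "anti Q" for Q
  proof (rule ccontr)
    assume "\<not> ?thesis"
    then have card: "n < card (insert z (trace ` Q))" and fin: "finite (insert z (trace ` Q))"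
      using that by (simp_all add: anti_def card_image)
    show False
    proof (rule C.no_wide_antichain[OF valid M tx fin card])
      fix \<nu> assume "\<nu> \<in> insert z (trace ` Q)"
      then show "\<nu> \<in> ultrafilters C \<and> canonical_rel C d (trace x) \<nu>"
        using that z trace_rel trace_ultrafilter[OF X_ultra] by (auto simp: anti_def)
    next
      fix \<nu> \<nu>' assume "\<nu> \<in> insert z (trace ` Q)" "\<nu>' \<in> insert z (trace ` Q)" "\<nu> \<noteq> \<nu>'"
      then show "\<not> boxes C d' True \<nu> \<subseteq> boxes C d' True \<nu>'"
        using that unfolding anti_def bx_def by blast
    qed
  qed
  have "anti {}" by (simp add: anti_def)
  then obtain Q where Q: "anti Q" and Q_max: "\<And>Q'. anti Q' \<Longrightarrow> card Q' \<le> card Q"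
    using ex_has_greatest_nat[of anti "{}" card n] bound by blast
  have QX: "finite Q" "\<And>q. q \<in> Q \<Longrightarrow> q \<in> X" using Q by (auto simp: anti_def)
  \<comment> \<open>Finitely many parameters from the subalgebra witness that \<open>z\<close> is incomparable with \<open>Q\<close>; the cell
    consists of the successors of \<open>x\<close> in \<open>S\<close> for which the same parameters work.\<close>
  have "\<exists>b c. b \<in> bx z - bx (trace q) \<and> c \<in> bx (trace q) - bx z" if "q \<in> Q" for q
  proof -
    have "z \<noteq> trace q" using Q that unfolding anti_def by blast
    then have "\<not> bx z \<subseteq> bx (trace q)" "\<not> bx (trace q) \<subseteq> bx z"
      using Q that unfolding anti_def by simp_all
    then show ?thesis by blast
  qed
  then obtain b c where bc: "\<And>q. q \<in> Q \<Longrightarrow> b q \<in> bx z - bx (trace q) \<and> c q \<in> bx (trace q) - bx z" by metis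
  obtain qs where qs: "set qs = Q" using QX finite_list by blast
  define bs where "bs = map (g \<circ> b) qs @ map (g \<circ> c) qs"
  define \<sigma> where "\<sigma> = map (\<lambda>_. True) qs @ map (\<lambda>_. False) qs"
  have bcC: "b q \<in> carrier C" "c q \<in> carrier C" if "q \<in> Q" for q
    using bc[OF that] by (auto simp: bx_def boxes_def)
  have bs_sub: "set bs \<subseteq> g ` carrier C" using bcC qs by (auto simp: bs_def)
  let ?sep = "\<lambda>u. \<forall>q\<in>Q. b q \<in> bx (trace u) \<and> c q \<notin> bx (trace u)"
  have cell_iff: "u \<in> cell A d d' S \<sigma> x bs \<longleftrightarrow>
      u \<in> ultrafilters A \<and> canonical_rel A d x u \<and> u \<in> S \<and> ?sep u" for u
  proof -
    have 1: "g (b q) \<in> boxes A d' True u \<longleftrightarrow> b q \<in> bx (trace u)" if "q \<in> Q" for q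
      using boxes_trace_iff[OF M(2) bcC(1)[OF that]] by (simp add: bx_def)
    have 2: "g (c q) \<in> boxes A d' False u \<longleftrightarrow> c q \<notin> bx (trace u)" if "q \<in> Q" for q
      using boxes_trace_iff[OF M(2) bcC(2)[OF that], of True] bcC(2)[OF that] g_closed
      by (auto simp: bx_def boxes_def)
    have "list_all2 (\<lambda>b e. b \<in> boxes A d' e u) bs \<sigma> \<longleftrightarrow> ?sep u"
      unfolding bs_def \<sigma>_def using 1 2 qs
      by (auto simp: list_all2_append list.rel_map list_all2_same)
    then show ?thesis by (auto simp: cell_def)
  qed
  let ?cell = "cell A d d' S \<sigma> x bs"
  define F where "F = (\<Union>u\<in>?cell. boxes A d' e u)"
  have \<mu>_cell: "\<mu> \<in> ?cell" using cell_iff \<mu>_ultra x\<mu> \<mu>(2) \<mu>_trace bc by auto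
  \<comment> \<open>By maximality of \<open>Q\<close> the reflected members of the cell are comparable with \<open>z\<close>, and by the
    assumption for contradiction only on the side that is not wanted.\<close>
  have comparable: "boxes C d' e (trace y) \<subseteq> boxes C d' e z" if y: "y \<in> X" "y \<in> ?cell" for y
  proof -
    have sep: "?sep y" and yS: "y \<in> S" "canonical_rel A d x y" using y cell_iff by auto
    have new: "\<not> bx (trace y) \<subseteq> bx (trace q)" "\<not> bx (trace q) \<subseteq> bx (trace y)" if "q \<in> Q" for q
      using sep bc[OF that] that by auto
    have "bx z \<subseteq> bx (trace y) \<or> bx (trace y) \<subseteq> bx z"
    proof (rule ccontr)
      assume inc: "\<not> ?thesis"
      have "trace y \<noteq> z" using inc by auto
      moreover have fresh: "trace y \<notin> trace ` Q"
      proof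
        assume "trace y \<in> trace ` Q"
        then obtain q where "q \<in> Q" "trace y = trace q" by blast
        then show False using new(1)[of q] by simp
      qed
      moreover have "y \<notin> Q" using fresh by blast
      ultimately have "anti (insert y Q)"
        using Q new inc y(1) yS unfolding anti_def by simp
      with \<open>y \<notin> Q\<close> show False using Q_max[of "insert y Q"] QX(1) by simp
    qed
    then show ?thesis using none y(1) yS(1) by (cases e) (auto simp: bx_def boxes_False)
  qed
  \<comment> \<open>Hence, as far as the subalgebra can see, \<open>F\<close> coincides with the corresponding set of \<open>z\<close>.\<close>
  have F_z: "b \<in> boxes C d' e z" if b: "b \<in> carrier C" "g b \<in> F" for b
  proof -
    obtain u where "u \<in> ?cell" "g b \<in> boxes A d' e u" using b unfolding F_def by blast
    then have "u \<in> cell A d d' S (e # \<sigma>) x (g b # bs)" by (simp add: cell_def)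
    moreover have "set (g b # bs) \<subseteq> g ` carrier C" using bs_sub b by simp
    ultimately obtain y where "y \<in> X" "y \<in> cell A d d' S (e # \<sigma>) x (g b # bs)"
      using reflect_populating[OF M S _ x] by blast
    then have "y \<in> X" "y \<in> ?cell" "g b \<in> boxes A d' e y" by (auto simp: cell_def)
    then show ?thesis using comparable[of y] boxes_trace_iff[OF M(2) b(1)] by blast
  qed
  have z_F: "g b \<in> F" if "b \<in> boxes C d' e z" for b
  proof -
    have "b \<in> carrier C" using that by (simp add: boxes_def)
    then show ?thesis using that \<mu>_cell boxes_trace_iff[OF M(2), of b e \<mu>] \<mu>_trace unfolding F_def by blast
  qed
  \<comment> \<open>Directedness: a finite set that no member of the cell covers could be found in the subalgebra, but
    there the lift \<open>\<mu>\<close>, which is in the cell, covers it.\<close>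
  have dir: "\<exists>u\<in>?cell. set as \<subseteq> boxes A d' e u" if as: "set as \<subseteq> F" for as
  proof (rule ccontr)
    assume "\<not> ?thesis"
    then have "spreading A d d' S \<sigma> e bs [x] as []" using as by (simp add: spreading_def F_def)
    moreover have "set as \<subseteq> carrier A" using as by (auto simp: F_def boxes_def)
    ultimately obtain cs where cs: "set cs \<subseteq> g ` carrier C" "spreading A d d' S \<sigma> e bs [x] cs []"
      using reflect_spreading[OF M S bs_sub x] by blast
    then have "set cs \<subseteq> F" by (simp add: spreading_def F_def)
    then have "set cs \<subseteq> boxes A d' e \<mu>"
      using cs(1) F_z boxes_trace_iff[OF M(2), of _ e \<mu>] \<mu>_trace by blast
    then show False using cs(2) \<mu>_cell by (auto simp: spreading_def)
  qed
  obtain u where u: "u \<in> ultrafilters A" "canonical_rel A d x u" "boxes A d' e u = F"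
    using cell_limit[OF M x_ultra dir[unfolded F_def]] unfolding F_def by blast
  obtain y where y: "y \<in> X" "boxes A d' e y = F"
    using reflect_limiting[OF M S bs_sub x u(1,2) u(3)[unfolded F_def]] unfolding F_def by blast
  \<comment> \<open>The reflected limit \<open>y\<close> has the same successors as \<open>z\<close>, hence as \<open>\<mu>\<close>, and so is in \<open>S\<close> as \<open>\<mu>\<close> is.\<close>
  have eq: "boxes C d' e (trace y) = boxes C d' e z"
  proof (rule set_eqI)
    fix b show "b \<in> boxes C d' e (trace y) \<longleftrightarrow> b \<in> boxes C d' e z"
    proof (cases "b \<in> carrier C")
      case True
      then show ?thesis using boxes_trace_iff[OF M(2) True, of e y] y(2) F_z z_F by blast
    qed (simp add: boxes_def)
  qed
  then have "boxes C d' e' (trace y) \<subseteq> boxes C d' e' z" for e'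
    using boxes_eqI[of C d' e "trace y" z e'] by simp
  then have "boxes A d' e' y \<subseteq> boxes A d' e' \<mu>" for e' using lifts_boxes[OF \<mu>(1) M(2) y(1)] by blast
  from this[of True] this[of False] have "boxes A d' True \<mu> = boxes A d' True y"
    by (auto simp: boxes_def)
  then have "y \<in> S" using S_sat[OF \<mu>_ultra X_ultra[OF y(1)]] \<mu>(2) by blast
  then show False using none y(1) eq by blast
qed

end

section \<open>Truth in the canonical extension of the subalgebra\<close>

primrec subterms :: "'m tm \<Rightarrow> 'm tm set" where
  "subterms (Var k) = {Var k}"
| "subterms Zero = {Zero}"
| "subterms One = {One}"
| "subterms (Compl t) = insert (Compl t) (subterms t)"
| "subterms (Join s t) = insert (Join s t) (subterms s \<union> subterms t)"
| "subterms (Oper d t) = insert (Oper d t) (subterms t)"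

lemma finite_subterms: "finite (subterms t)"
  by (induction t) auto

lemma self_in_subterms: "t \<in> subterms t"
  by (cases t) auto

context reflecting_subalgebra
begin

definition lift :: "'c set \<Rightarrow> 'a set" where
  "lift w = (SOME \<mu>. lifts w \<mu>)"

lemma lifts_lift: "w \<in> ultrafilters C \<Longrightarrow> lifts w (lift w)"
  unfolding lift_def by (rule someI_ex) (rule lifts_exists)

lemma lift_ultra: "w \<in> ultrafilters C \<Longrightarrow> lift w \<in> ultrafilters A"
  using lifts_lift unfolding lifts_def by blast

lemma lift_trace: "x \<in> X \<Longrightarrow> lift (trace x) = x"
  using lifts_trace lifts_lift trace_ultrafilter X_ultra by blast

text \<open>The part of the canonical frame on which truth is controlled: within it, every ultrafilter outside
the traces is seen by a trace, as is required for bounding the width of its surroundings.\<close>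

definition near :: "'c set \<Rightarrow> bool" where
  "near z \<longleftrightarrow> z \<in> ultrafilters C \<and>
     (\<exists>x\<in>X. z = trace x \<or> (\<exists>d\<in>M. canonical_rel C d (trace x) z))"

lemma near_ultra: "near z \<Longrightarrow> z \<in> ultrafilters C"
  by (simp add: near_def)

lemma near_trace: "x \<in> X \<Longrightarrow> near (trace x)"
  using trace_ultrafilter X_ultra unfolding near_def by blast

lemma near_sandwich:
  assumes valid: "\<And>d d'. d \<in> M \<Longrightarrow> d' \<in> M \<Longrightarrow> satisfies C (translate (U_formula n d d')) One"
    and d': "d' \<in> M" and S: "S \<in> \<S>"
    and S_sat: "\<And>u u'. u \<in> ultrafilters A \<Longrightarrow> u' \<in> ultrafilters A \<Longrightarrow>
      boxes A d' True u = boxes A d' True u' \<Longrightarrow> u \<in> S \<Longrightarrow> u' \<in> S"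
    and z: "near z" "lift z \<in> S"
  shows "\<exists>y\<in>X. y \<in> S \<and> boxes C d' e z \<subseteq> boxes C d' e (trace y)"
proof -
  obtain x where x: "x \<in> X" "z = trace x \<or> (\<exists>d\<in>M. canonical_rel C d (trace x) z)"
    using z(1) unfolding near_def by blast
  from x(2) show ?thesis
  proof
    assume "z = trace x"
    then show ?thesis using x(1) z(2) lift_trace by auto
  next
    assume "\<exists>d\<in>M. canonical_rel C d (trace x) z"
    then obtain d where d: "d \<in> M" "canonical_rel C d (trace x) z" by blast
    show ?thesis
      by (rule sandwich[OF d(1) d' S S_sat valid[OF d(1) d'] x(1) near_ultra[OF z(1)] d(2)
            lifts_lift[OF near_ultra[OF z(1)]] z(2)])
  qed
qed

lemma canonical_rel_by_boxes:
  assumes "d \<in> M" "u \<in> ultrafilters C" "z \<in> ultrafilters C" "w \<in> ultrafilters C"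
    and "boxes C d True u \<subseteq> boxes C d True z" "canonical_rel C d z w"
  shows "canonical_rel C d u w"
  using assms C.canonical_rel_iff[of _ w d] by blast

text \<open>The sandwich lemma for the set of all ultrafilters provides a \<open>y \<in> X\<close> whose trace has at least the
successors of \<open>z\<close>; hence nearness does not degrade along chains of successors.\<close>

lemma near_successor:
  assumes valid: "\<And>d d'. d \<in> M \<Longrightarrow> d' \<in> M \<Longrightarrow> satisfies C (translate (U_formula n d d')) One"
    and top: "ultrafilters A \<in> \<S>"
    and z: "near z" and d: "d \<in> M" and w: "w \<in> ultrafilters C" "canonical_rel C d z w"
  shows "near w"
proof -
  have "\<exists>y\<in>X. y \<in> ultrafilters A \<and> boxes C d False z \<subseteq> boxes C d False (trace y)"
    by (rule near_sandwich[OF valid d top _ z lift_ultra[OF near_ultra[OF z]]])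
  then obtain y where y: "y \<in> X" "boxes C d False z \<subseteq> boxes C d False (trace y)" by blast
  then have "boxes C d True (trace y) \<subseteq> boxes C d True z" by (auto simp: boxes_def)
  then have "canonical_rel C d (trace y) w"
    using canonical_rel_by_boxes[OF d trace_ultrafilter[OF X_ultra[OF y(1)]] near_ultra[OF z] w(1) _ w(2)] by blast
  then show ?thesis using y(1) d w(1) unfolding near_def by blast
qed

text \<open>A diamond that fails at the lift of \<open>z\<close> fails at some \<open>y \<in> X\<close> whose trace sees all successors of \<open>z\<close>;
since lifts preserve being a successor of \<open>y\<close>, none of these can witness it. A diamond that holds at
the lift holds at some \<open>y \<in> X\<close> whose trace sees at most the successors of \<open>z\<close>; it has a witness in
\<open>X\<close>, and \<open>z\<close> sees the trace of that.\<close>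

lemma truth_reflected:
  fixes v :: "nat \<Rightarrow> 'a set set"
  defines "v' \<equiv> \<lambda>k. {w \<in> ultrafilters C. lift w \<in> v k}"
  assumes valid: "\<And>d d'. d \<in> M \<Longrightarrow> d' \<in> M \<Longrightarrow> satisfies C (translate (U_formula n d d')) One"
    and top: "ultrafilters A \<in> \<S>"
    and v: "range v \<subseteq> Pow (ultrafilters A)"
    and "ops t \<subseteq> M"
    and "\<And>r. r \<in> subterms t \<Longrightarrow> eval (canonical_extension A) v r \<in> \<S> \<and>
      ultrafilters A - eval (canonical_extension A) v r \<in> \<S>"
    and "near z"
  shows "z \<in> eval (canonical_extension C) v' t \<longleftrightarrow> lift z \<in> eval (canonical_extension A) v t"
  using assms(5-7)
proof (induction t arbitrary: z)
  case (Oper d t)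
  let ?EA = "eval (canonical_extension A) v" and ?EC = "eval (canonical_extension C) v'"
  have d: "d \<in> M" and IH: "\<And>w. near w \<Longrightarrow> w \<in> ?EC t \<longleftrightarrow> lift w \<in> ?EA t"
    using Oper by auto
  have tS: "?EA t \<in> \<S>" "?EA (Oper d t) \<in> \<S>" "ultrafilters A - ?EA (Oper d t) \<in> \<S>"
    using Oper.prems(2) self_in_subterms[of t] by (simp_all del: eval.simps)
  have EA: "?EA (Oper d t) = {\<mu> \<in> ultrafilters A. \<exists>\<nu>\<in>?EA t. canonical_rel A d \<mu> \<nu>}"
    and EC: "?EC (Oper d t) = {\<mu> \<in> ultrafilters C. \<exists>\<nu>\<in>?EC t. canonical_rel C d \<mu> \<nu>}"
    by (simp_all add: canonical_extension_def)
  have EA_sub: "?EA t \<subseteq> ultrafilters A"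
    using bao.eval_closed[OF canonical_extension_bao, of v A t M] v Oper.prems(1)
    by (simp add: canonical_extension_def)
  have "range v' \<subseteq> Pow (ultrafilters C)" by (auto simp: v'_def)
  then have EC_sub: "?EC t \<subseteq> ultrafilters C"
    using bao.eval_closed[OF canonical_extension_bao, of v' C t M] Oper.prems(1)
    by (simp add: canonical_extension_def)
  have sat: "u' \<in> ?EA (Oper d t)"
    if u: "u \<in> ultrafilters A" "u' \<in> ultrafilters A" "boxes A d True u = boxes A d True u'"
      "u \<in> ?EA (Oper d t)" for u u'
  proof -
    obtain \<nu> where \<nu>: "\<nu> \<in> ?EA t" "canonical_rel A d u \<nu>" using u(4) EA by auto
    then have "canonical_rel A d u' \<nu>"
      using u(1-3) EA_sub A.canonical_rel_iff[of _ \<nu> d] d by (metis subsetD)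
    then show ?thesis using \<nu>(1) u(2) EA by auto
  qed
  have z: "z \<in> ultrafilters C" using near_ultra[OF Oper.prems(3)] .
  show ?case
  proof
    assume "z \<in> ?EC (Oper d t)"
    then obtain w where w: "w \<in> ?EC t" "canonical_rel C d z w" using EC by auto
    have w_ultra: "w \<in> ultrafilters C" using w(1) EC_sub by blast
    have w_near: "near w" by (rule near_successor[OF valid top Oper.prems(3) d w_ultra w(2)])
    then have lw: "lift w \<in> ?EA t" using IH w(1) by blast
    show "lift z \<in> ?EA (Oper d t)"
    proof (rule ccontr)
      assume "lift z \<notin> ?EA (Oper d t)"
      then have "lift z \<in> ultrafilters A - ?EA (Oper d t)" using lift_ultra[OF z] by blast
      moreover have "u' \<in> ultrafilters A - ?EA (Oper d t)"
        if "u \<in> ultrafilters A" "u' \<in> ultrafilters A" "boxes A d True u = boxes A d True u'"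
          "u \<in> ultrafilters A - ?EA (Oper d t)" for u u'
        using sat[OF that(2,1) that(3)[symmetric]] that(2,4) by blast
      ultimately have "\<exists>y\<in>X. y \<in> ultrafilters A - ?EA (Oper d t) \<and>
          boxes C d False z \<subseteq> boxes C d False (trace y)"
        by (intro near_sandwich[OF valid d tS(3) _ Oper.prems(3)])
      then obtain y where y: "y \<in> X" "y \<notin> ?EA (Oper d t)" "boxes C d False z \<subseteq> boxes C d False (trace y)"
        by blast
      have "boxes C d True (trace y) \<subseteq> boxes C d True z" using y(3) by (auto simp: boxes_def)
      then have "boxes C d True (trace y) \<subseteq> w"
        using w(2) C.canonical_rel_iff[OF z w_ultra d] by blast
      then have "canonical_rel A d y (lift w)" by (rule lifts_successor[OF lifts_lift[OF w_ultra] d y(1)])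
      then show False using y(1,2) lw EA X_ultra by auto
    qed
  next
    assume "lift z \<in> ?EA (Oper d t)"
    then have "\<exists>y\<in>X. y \<in> ?EA (Oper d t) \<and> boxes C d True z \<subseteq> boxes C d True (trace y)"
      by (intro near_sandwich[OF valid d tS(2) _ Oper.prems(3)]) (assumption | erule (2) sat)+
    then obtain y where y: "y \<in> X" "y \<in> ?EA (Oper d t)" "boxes C d True z \<subseteq> boxes C d True (trace y)"
      by blast
    then obtain \<nu> where "\<nu> \<in> ?EA t" "canonical_rel A d y \<nu>" using EA by auto
    then have "\<nu> \<in> cell A d d (?EA t) [] y []" using EA_sub by (auto simp: cell_def)
    then obtain u where "u \<in> X" "u \<in> cell A d d (?EA t) [] y []"
      using reflect_populating[OF d d tS(1) _ y(1)] by (metis empty_set empty_subsetI)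
    then have u: "u \<in> X" "u \<in> ?EA t" "canonical_rel A d y u" by (auto simp: cell_def)
    have "boxes A d True y \<subseteq> u" using A.canonical_rel_iff[OF X_ultra[OF y(1)] X_ultra[OF u(1)] d] u(3) by blast
    then have "boxes C d True (trace y) \<subseteq> trace u"
      using boxes_trace_iff[OF d, of _ True y] by (auto simp: trace_def boxes_def)
    then have "canonical_rel C d z (trace u)"
      using C.canonical_rel_iff[OF z trace_ultrafilter[OF X_ultra[OF u(1)]] d] y(3) by blast
    moreover have "trace u \<in> ?EC t" using IH[OF near_trace[OF u(1)]] lift_trace[OF u(1)] u(2) by simp
    ultimately show "z \<in> ?EC (Oper d t)" using z EC by blast
  qed
qed (auto simp: canonical_extension_def v'_def near_ultra lift_ultra)

end

section \<open>Canonicity transfers from countable algebras\<close>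

lemma reflects_operation:
  assumes "reflects (reflected_rels M A \<S>) (carrier A) CX B X"
    and "f \<in> operations M A" "set bs \<subseteq> B" "f bs \<in> carrier A"
  shows "f bs \<in> B"
proof -
  have "op_rel f \<in> reflected_rels M A \<S>" using assms(2) unfolding reflected_rels_def by blast
  moreover have "\<exists>cs\<in>lists (carrier A). \<exists>ys\<in>lists CX. op_rel f bs [] cs ys"
    using assms(4) by (intro bexI[of _ "[f bs]"] bexI[of _ "[]"]) (auto simp: op_rel_def)
  moreover have "bs \<in> lists B" using assms(3) by auto
  moreover have "[] \<in> lists X" by simp
  ultimately have "\<exists>cs\<in>lists B. \<exists>ys\<in>lists X. op_rel f bs [] cs ys"
    using assms(1) unfolding reflects_def by blast
  then show ?thesis by (auto simp: op_rel_def)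
qed

text \<open>Countable canonicity speaks of algebras on the type \<open>'b\<close>, so the countable subalgebra is
moved there along an injection.\<close>

lemma countable_subalgebra_copy:
  fixes A :: "('a, 'm) algebra"
  assumes "bao M A" "B \<subseteq> carrier A" "countable B" "infinite (UNIV :: 'b set)"
    and "zero A \<in> B" "one A \<in> B" "\<And>a. a \<in> B \<Longrightarrow> compl A a \<in> B"
    and "\<And>a b. a \<in> B \<Longrightarrow> b \<in> B \<Longrightarrow> join A a b \<in> B"
    and "\<And>d a. d \<in> M \<Longrightarrow> a \<in> B \<Longrightarrow> dia A d a \<in> B"
  shows "\<exists>(C :: ('b, 'm) algebra) g. embedding M A C g \<and> g ` carrier C = B"
proof -
  obtain h :: "nat \<Rightarrow> 'b" where "inj h" using infinite_countable_subset[OF assms(4)] by blast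
  then have "inj_on (h \<circ> to_nat_on B) B"
    using inj_on_to_nat_on[OF assms(3)] by (auto intro: comp_inj_on inj_on_subset)
  then obtain f :: "'a \<Rightarrow> 'b" where f: "inj_on f B" by blast
  define g where "g = inv_into B f"
  define C where "C = \<lparr>carrier = f ` B, join = \<lambda>x y. f (join A (g x) (g y)),
    compl = \<lambda>x. f (compl A (g x)), zero = f (zero A), one = f (one A), dia = \<lambda>d x. f (dia A d (g x))\<rparr>"
  have gf: "g (f b) = b" if "b \<in> B" for b using that f by (simp add: g_def)
  have gB: "g x \<in> B" "f (g x) = x" if "x \<in> f ` B" for x using that gf by auto
  interpret bao M A by fact
  have "embedding M A C g"
  proof
    show "inj_on g (carrier C)" unfolding C_def algebra.simps by (rule inj_onI) (metis gB(2))
  qed (use assms(2,5-9) gf gB in \<open>auto simp: C_def\<close>)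
  moreover have "g ` carrier C = B" using gf by (force simp: C_def image_iff)
  ultimately show ?thesis by blast
qed

lemma generated_carrier: "bao M A \<Longrightarrow> generated M A (carrier A) = carrier A"
proof (intro equalityI subsetI)
  fix a assume "bao M A" "a \<in> generated M A (carrier A)"
  then interpret bao M A by simp
  from \<open>a \<in> generated M A (carrier A)\<close> show "a \<in> carrier A" by (induction rule: generated.induct) auto
qed (rule generated.gen)

theorem theorem7p7:
  fixes M :: "'m set" and E :: "('m tm \<times> 'm tm) set" and n :: nat
  assumes "M \<noteq> {}" and "countable M"
    and "E \<subseteq> terms M \<times> terms M"
    and "infinite (UNIV :: 'b set)"
    and "0 < n"
    and "KU n M \<subseteq> logic_of TYPE('b) M E"
  shows "totally_canonical TYPE('a) M E \<or> \<not> canonical TYPE('b) ( |M| +c natLeq) M E"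
proof (rule disjCI)
  assume "\<not> \<not> canonical TYPE('b) ( |M| +c natLeq) M E"
  then have canonical: "canonical TYPE('b) ( |M| +c natLeq) M E" by simp
  show "totally_canonical TYPE('a) M E"
    unfolding totally_canonical_def
  proof (rule ballI, rule ccontr)
    fix A :: "('a, 'm) algebra"
    assume A: "A \<in> variety M E" and "canonical_extension A \<notin> variety M E"
    have bao: "bao M A" using A by (simp add: variety_def)
    let ?EA = "eval (canonical_extension A)"
    have "carrier (canonical_extension A) = Pow (ultrafilters A)" by (simp add: canonical_extension_def)
    moreover obtain s t where st: "(s, t) \<in> E" and "\<not> satisfies (canonical_extension A) s t"
      using \<open>canonical_extension A \<notin> variety M E\<close> canonical_extension_bao[of M A]
      unfolding variety_def by auto
    ultimately obtain v where v: "range v \<subseteq> Pow (ultrafilters A)" and neq: "?EA v s \<noteq> ?EA v t"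
      unfolding satisfies_def by auto
    have ops: "ops s \<subseteq> M" "ops t \<subseteq> M" using assms(3) st by (auto simp: terms_def)
    have "?EA v r \<subseteq> ultrafilters A" if "ops r \<subseteq> M" for r
      using bao.eval_closed[OF canonical_extension_bao, of v A r M] v that
      by (simp add: canonical_extension_def)
    then obtain x where x: "x \<in> ultrafilters A" "(x \<in> ?EA v s) \<noteq> (x \<in> ?EA v t)"
      using neq ops by blast
    \<comment> \<open>Finitely many truth sets suffice, as the induction over terms meets only subterms of the
      equation.\<close>
    define \<S> where "\<S> = insert (ultrafilters A)
      (\<Union>r\<in>subterms s \<union> subterms t. {?EA v r, ultrafilters A - ?EA v r})"
    have "countable \<S>" unfolding \<S>_def by (intro countable_finite) (simp add: finite_subterms)
    then have "countable (reflected_rels M A \<S>)" by (rule countable_reflected_rels[OF assms(2)])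
    moreover have "countable {x}" "{x} \<subseteq> ultrafilters A" using x(1) by simp_all
    ultimately obtain B X where B: "B \<subseteq> carrier A" "countable B" and X: "{x} \<subseteq> X" "X \<subseteq> ultrafilters A"
      and reflects: "reflects (reflected_rels M A \<S>) (carrier A) (ultrafilters A) B X"
      by (rule countable_reflection[where CA = "carrier A"])
    have xX: "x \<in> X" using X(1) by simp
    interpret A: bao M A by fact
    note op = reflects_operation[OF reflects]
    have "zero A \<in> B" "one A \<in> B" using op[of "\<lambda>_. zero A" "[]"] op[of "\<lambda>_. one A" "[]"] by (auto simp: operations_def)
    moreover have "compl A a \<in> B" if "a \<in> B" for a
      using op[of "\<lambda>bs. compl A (hd bs)" "[a]"] that B(1) by (auto simp: operations_def)
    moreover have "join A a b \<in> B" if "a \<in> B" "b \<in> B" for a b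
      using op[of "\<lambda>bs. join A (hd bs) (bs ! 1)" "[a, b]"] that B(1) by (auto simp: operations_def)
    moreover have "dia A d a \<in> B" if "d \<in> M" "a \<in> B" for d a
      using op[of "\<lambda>bs. dia A d (hd bs)" "[a]"] that B(1) by (auto simp: operations_def)
    ultimately obtain C :: "('b, 'm) algebra" and g where g: "embedding M A C g" "g ` carrier C = B"
      using countable_subalgebra_copy[OF bao B assms(4)] by metis
    interpret embedding M A C g by fact
    interpret reflecting_subalgebra M A C g X \<S>
      by standard (use X reflects g in auto)
    have C: "C \<in> variety M E" by (rule subalgebra_in_variety[OF A assms(3)])
    have valid: "satisfies C (translate (U_formula n d d')) One" if "d \<in> M" "d' \<in> M" for d d'
      by (rule U_formula_in_logic[OF assms(6) that C])
    have "countable (carrier C)" using g(2) B(2) g_inj countable_image_inj_on by metis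
    then have "|carrier C| \<le>o |M| +c natLeq"
      using countable_card_le_natLeq ordLeq_transitive ordLeq_csum2[OF natLeq_Card_order] by blast
    then have "canonical_extension C \<in> variety M E"
      using canonical C generated_carrier[OF subalgebra_bao] unfolding canonical_def by blast
    then have sat: "satisfies (canonical_extension C) s t" using st unfolding variety_def by auto
    define v' where "v' = (\<lambda>k. {w \<in> ultrafilters C. lift w \<in> v k})"
    have "range v' \<subseteq> carrier (canonical_extension C)"
      by (auto simp: v'_def canonical_extension_def)
    then have eq: "eval (canonical_extension C) v' s = eval (canonical_extension C) v' t"
      using sat by (simp add: satisfies_def)
    have "trace x \<in> eval (canonical_extension C) v' r \<longleftrightarrow> x \<in> ?EA v r"
      if "r = s \<or> r = t" for r
      using truth_reflected[OF valid _ v, of r "trace x"] near_trace[OF xX] lift_trace[OF xX] ops that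
      unfolding v'_def by (auto simp: \<S>_def)
    then show False using eq x(2) by blast
  qed
qed

end
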